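(* Let $F$ and $G$ be continuous distributions on $\mathbb R$, let $\theta\in(0,1)$, and let $(\tau_n)$ be integers with $1\le\tau_n<n$ and $\tau_n/n\to\theta$. For each $n$ let $Y_1,\ldots,Y_n$ be independent with $Y_i\sim F$ for $i\le\tau_n$ and $Y_i\sim G$ for $i>\tau_n$. Let $H=\theta F+(1-\theta)G$ (as distribution functions), and for independent $X_F\sim F$, $X_G\sim G$ define $$\delta_U=\Pr(X_F>X_G)-\tfrac12,\qquad \delta_M=E\Big[\big\{H(X_F)-\tfrac12\big\}^2\Big]-E\Big[\big\{H(X_G)-\tfrac12\big\}^2\Big].$$ Fix $\varepsilon>0$ with $\theta\in(\varepsilon,1-\varepsilon)$ and, for $n$ large, let $$\hat\tau_n=\arg\max_{\varepsilon n\le k\le(1-\varepsilon)n}L^k_{1,n},$$ the maximum being over integers $k$ and ties in the maximizer being broken arbitrarily. If $\delta_U^2+\delta_M^2>0$, then $$\hat\tau_n/n\xrightarrow{p}\theta\qquad(n\to\infty).$$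
   Context: The statistic $L^k_{1,n}$ is the Lepage-type rank statistic computed from $Y_1,\ldots,Y_n$ as follows. For $1\le k<n$ put $n_1=k$, $n_2=n-k$, and let $r_i=\sum_{j=1}^n I(Y_i\ge Y_j)$ be the rank of $Y_i$ among $Y_1,\ldots,Y_n$. Let $$U^k_{1,n}=\sum_{i=1}^k r_i-\frac{n_1(n_1+1)}{2},\qquad M^k_{1,n}=\sum_{i=1}^k\Big(r_i-\frac{n+1}{2}\Big)^2,$$ and $$L^k_{1,n}=\frac{\big(U^k_{1,n}-\frac{n_1n_2}{2}\big)^2}{n_1n_2(n+1)/12}+\frac{\big(M^k_{1,n}-\frac{n_1(n^2-1)}{12}\big)^2}{n_1n_2(n+1)(n^2-4)/180}.$$ "Continuous distribution" means that the cumulative distribution function is continuous; $F$, $G$, $H$ also denote the cumulative distribution functions. $\xrightarrow{p}$ denotes convergence in probability. *)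

theory Defs
  imports "HOL-Probability.Probability"
begin

text \<open>A sample is a function \<open>y :: nat \<Rightarrow> real\<close>, of which only the values
  \<open>y 1, \<dots>, y n\<close> are used.\<close>

definition sample_rank :: "nat \<Rightarrow> (nat \<Rightarrow> real) \<Rightarrow> nat \<Rightarrow> real" where
  "sample_rank n y i = (\<Sum>j = 1..n. of_bool (y i \<ge> y j))"

definition U_stat :: "nat \<Rightarrow> (nat \<Rightarrow> real) \<Rightarrow> nat \<Rightarrow> real" where
  "U_stat n y k = (\<Sum>i = 1..k. sample_rank n y i) - real k * (real k + 1) / 2"

definition M_stat :: "nat \<Rightarrow> (nat \<Rightarrow> real) \<Rightarrow> nat \<Rightarrow> real" where
  "M_stat n y k = (\<Sum>i = 1..k. (sample_rank n y i - (real n + 1) / 2)\<^sup>2)"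

text \<open>Intended for \<open>1 \<le> k < n\<close> and \<open>n > 2\<close>, where both denominators are positive.\<close>

definition lepage :: "nat \<Rightarrow> (nat \<Rightarrow> real) \<Rightarrow> nat \<Rightarrow> real" where
  "lepage n y k =
    (let N = real n; n1 = real k; n2 = real n - real k in
      (U_stat n y k - n1 * n2 / 2)\<^sup>2 / (n1 * n2 * (N + 1) / 12) +
      (M_stat n y k - n1 * (N\<^sup>2 - 1) / 12)\<^sup>2 / (n1 * n2 * (N + 1) * (N\<^sup>2 - 4) / 180))"

definition mixture_cdf :: "real \<Rightarrow> real measure \<Rightarrow> real measure \<Rightarrow> real \<Rightarrow> real" where
  "mixture_cdf \<theta> F G x = \<theta> * cdf F x + (1 - \<theta>) * cdf G x"

text \<open>Convergence in probability to a constant, along a sequence of probability spaces.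
  A selection from the set of maximizers need not be measurable, so the outer
  probability is used; for random variables this is the usual notion, as the lemma
  below shows.\<close>

definition converges_in_prob :: "(nat \<Rightarrow> 'a measure) \<Rightarrow> (nat \<Rightarrow> 'a \<Rightarrow> real) \<Rightarrow> real \<Rightarrow> bool" where
  "converges_in_prob P X c \<longleftrightarrow>
    (\<forall>\<eta>>0. (\<lambda>n. outer_measure_of (P n) {\<omega> \<in> space (P n). \<bar>X n \<omega> - c\<bar> > \<eta>}) \<longlonglongrightarrow> 0)"

lemma converges_in_prob_iff_measurable:
  assumes "\<And>n. prob_space (P n)" "\<And>n. X n \<in> borel_measurable (P n)"
  shows "converges_in_prob P X c \<longleftrightarrow>
    (\<forall>\<eta>>0. (\<lambda>n. measure (P n) {\<omega> \<in> space (P n). \<bar>X n \<omega> - c\<bar> > \<eta>}) \<longlonglongrightarrow> 0)"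
proof -
  have meas: "{\<omega> \<in> space (P n). \<bar>X n \<omega> - c\<bar> > \<eta>} \<in> sets (P n)" for n \<eta>
    using assms(2)[of n] by measurable
  have "outer_measure_of (P n) {\<omega> \<in> space (P n). \<bar>X n \<omega> - c\<bar> > \<eta>} =
      ennreal (measure (P n) {\<omega> \<in> space (P n). \<bar>X n \<omega> - c\<bar> > \<eta>})" for n \<eta>
    using outer_measure_of_eq[OF meas]
      finite_measure.emeasure_eq_measure[OF prob_space.finite_measure[OF assms(1)]] by metis
  then show ?thesis
    unfolding converges_in_prob_def by (simp add: tendsto_ennreal_iff flip: ennreal_0)
qed

end

theory Submission
  imports Defs "HOL-Real_Asymp.Real_Asymp"
begin

text \<open>
  With \<open>t = k/n\<close>, the centred statistics \<open>U\<close> and \<open>M\<close>, divided by \<open>n\<^sup>2\<close> and \<open>n\<^sup>3\<close>, are averages over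
  \<open>i \<le> k\<close> of \<open>r\<^sub>i/n - 1/2\<close> and \<open>(r\<^sub>i/n - 1/2)\<^sup>2 - 1/12\<close>, up to \<open>O(1/n)\<close>. Since \<open>r\<^sub>i/n\<close> is the empirical
  distribution function at \<open>Y\<^sub>i\<close>, it may be replaced by \<open>H(Y\<^sub>i)\<close>: the empirical distribution function
  is close to \<open>H\<close> at finitely many quantiles of \<open>H\<close>, hence everywhere by monotonicity. Hoeffding's
  inequality and a union bound over \<open>k\<close> then give, uniformly in \<open>k\<close>, the limits \<open>h(t) \<delta>\<^sub>U\<close> and
  \<open>h(t) \<delta>\<^sub>M\<close>, where \<open>h(t) = min t \<theta> - t \<theta>\<close>; the centring 1/12 is right because \<open>H(X)\<close> is
  uniformly distributed for \<open>X \<sim> H\<close>. So the Lepage statistic divided by \<open>n\<close> is uniformly close to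
  a positive multiple of \<open>h(t)\<^sup>2 / (t (1 - t))\<close>, which falls off from its maximum at \<open>\<theta>\<close> at least
  linearly.
\<close>

section \<open>Moments of distribution functions\<close>

lemma cdf_borel_measurable:
  assumes "real_distribution M"
  shows "cdf M \<in> borel_measurable borel"
proof -
  interpret real_distribution M by fact
  show ?thesis by (intro borel_measurable_mono monoI cdf_nondecreasing)
qed

lemma cdf_eq_measure_lessThan:
  assumes "real_distribution M" "continuous_on UNIV (cdf M)"
  shows "cdf M x = measure M {..<x}"
proof -
  interpret real_distribution M by fact
  have "measure M {x} = 0"
    using assms(2) isCont_cdf[of x] by (simp add: continuous_on_eq_continuous_at)
  then show ?thesis
    unfolding cdf_def ivl_disj_un(2)[symmetric]
    by (subst finite_measure_Union) auto
qed

text \<open>Fubini: \<open>cdf N x\<close> is the \<open>N\<close>-mass of the half-line up to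
  \<open>x\<close>. The weight \<open>u\<close> stays free because both a constant and another
  distribution function occur later; its bound gives integrability.\<close>

lemma integral_mult_cdf_le:
  fixes u :: "real \<Rightarrow> real"
  assumes M: "real_distribution M" and N: "real_distribution N"
    and u [measurable]: "u \<in> borel_measurable borel" and u_le: "\<And>x. \<bar>u x\<bar> \<le> 1"
  shows "(\<integral>x. u x * cdf N x \<partial>M) = (\<integral>(x, y). u x * of_bool (y \<le> x) \<partial>(M \<Otimes>\<^sub>M N))"
proof -
  interpret M: real_distribution M by fact
  interpret N: real_distribution N by fact
  interpret pair_prob_space M N ..
  have int: "integrable (M \<Otimes>\<^sub>M N) (\<lambda>(x, y). u x * of_bool (y \<le> x))"
    by (rule P.integrable_const_bound[where B = 1]) (auto simp: u_le)
  have "(\<integral>y. u x * of_bool (y \<le> x) \<partial>N) = u x * cdf N x" for x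
  proof -
    have "of_bool (y \<le> x) = (indicator {..x} y :: real)" for y
      by (simp add: indicator_def)
    then show ?thesis by (simp add: cdf_def)
  qed
  then show ?thesis
    using integral_fst'[OF int] by (simp only: split_conv)
qed

text \<open>Continuity of \<open>cdf N\<close> excludes atoms, so the open half-line has the same
  mass. The strict and weak forms together split the plane into disjoint events, which settles
  ties.\<close>

lemma integral_mult_cdf_less:
  fixes u :: "real \<Rightarrow> real"
  assumes M: "real_distribution M" and N: "real_distribution N" "continuous_on UNIV (cdf N)"
    and u [measurable]: "u \<in> borel_measurable borel" and u_le: "\<And>x. \<bar>u x\<bar> \<le> 1"
  shows "(\<integral>x. u x * cdf N x \<partial>M) = (\<integral>(x, y). u x * of_bool (y < x) \<partial>(M \<Otimes>\<^sub>M N))"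
proof -
  interpret M: real_distribution M by fact
  interpret N: real_distribution N by fact
  interpret pair_prob_space M N ..
  have int: "integrable (M \<Otimes>\<^sub>M N) (\<lambda>(x, y). u x * of_bool (y < x))"
    by (rule P.integrable_const_bound[where B = 1]) (auto simp: u_le)
  have "(\<integral>y. u x * of_bool (y < x) \<partial>N) = u x * cdf N x" for x
  proof -
    have "of_bool (y < x) = (indicator {..<x} y :: real)" for y
      by (simp add: indicator_def)
    then show ?thesis by (simp add: cdf_eq_measure_lessThan[OF N])
  qed
  then show ?thesis
    using integral_fst'[OF int] by (simp only: split_conv)
qed

lemma integral_pair_swap:
  fixes f :: "real \<Rightarrow> real \<Rightarrow> real"
  assumes "real_distribution M" "real_distribution N"
    and [measurable]: "(\<lambda>(x, y). f x y) \<in> borel_measurable (borel \<Otimes>\<^sub>M borel)"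
  shows "(\<integral>(y, x). f x y \<partial>(N \<Otimes>\<^sub>M M)) = (\<integral>(x, y). f x y \<partial>(M \<Otimes>\<^sub>M N))"
proof -
  interpret M: real_distribution M by fact
  interpret N: real_distribution N by fact
  interpret pair_prob_space M N ..
  have "(\<lambda>(x, y). f x y) \<in> borel_measurable (M \<Otimes>\<^sub>M N)"
    by measurable
  from integral_product_swap[OF this] show ?thesis
    by simp
qed

text \<open>Under the product law both integrals are probabilities, of the complementary events
  \<open>y < x\<close> and \<open>x \<le> y\<close>. \<open>M\<close> is arbitrary so that it can
  later be the law of a maximum.\<close>

lemma integral_cdf_add_swap:
  assumes M: "real_distribution M" and N: "real_distribution N" "continuous_on UNIV (cdf N)"
  shows "(\<integral>x. cdf N x \<partial>M) + (\<integral>x. cdf M x \<partial>N) = 1"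
proof -
  interpret M: real_distribution M by fact
  interpret N: real_distribution N by fact
  interpret pair_prob_space M N ..
  have int: "integrable (M \<Otimes>\<^sub>M N) (\<lambda>(x, y). of_bool (y < x) :: real)"
    "integrable (M \<Otimes>\<^sub>M N) (\<lambda>(x, y). of_bool (x \<le> y) :: real)"
    by (rule P.integrable_const_bound[where B = 1]; auto)+
  have "(\<integral>x. cdf N x \<partial>M) = (\<integral>(x, y). of_bool (y < x) \<partial>(M \<Otimes>\<^sub>M N))"
    using integral_mult_cdf_less[OF M N, of "\<lambda>_. 1"] by simp
  moreover have "(\<integral>x. cdf M x \<partial>N) = (\<integral>(x, y). of_bool (x \<le> y) \<partial>(M \<Otimes>\<^sub>M N))"
    using integral_mult_cdf_le[OF N(1) M, of "\<lambda>_. 1"]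
      integral_pair_swap[OF M N(1), of "\<lambda>x y. of_bool (x \<le> y)"] by simp
  moreover have "(\<integral>(x, y). of_bool (y < x) \<partial>(M \<Otimes>\<^sub>M N)) + (\<integral>(x, y). of_bool (x \<le> y) \<partial>(M \<Otimes>\<^sub>M N))
      = (1 :: real)"
  proof -
    have "(case z of (x, y) \<Rightarrow> of_bool (y < x)) + (case z of (x, y) \<Rightarrow> of_bool (x \<le> y)) = (1 :: real)"
      for z :: "real \<times> real"
      by (cases z) auto
    then show ?thesis
      by (subst Bochner_Integration.integral_add[OF int, symmetric]) (simp add: P.prob_space)
  qed
  ultimately show ?thesis by simp
qed

text \<open>The three integrals are the probabilities that the first, second or third of three
  independent variables with laws \<open>A\<close>, \<open>B\<close>, \<open>C\<close> is the largest.\<close>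

lemma integral_cdf_mult_cyclic:
  assumes A: "real_distribution A" "continuous_on UNIV (cdf A)"
    and B: "real_distribution B" "continuous_on UNIV (cdf B)"
    and C: "real_distribution C" "continuous_on UNIV (cdf C)"
  shows "(\<integral>x. cdf B x * cdf C x \<partial>A) + (\<integral>x. cdf A x * cdf C x \<partial>B)
    + (\<integral>x. cdf A x * cdf B x \<partial>C) = 1"
proof -
  interpret A: real_distribution A by fact
  interpret B: real_distribution B by fact
  interpret C: real_distribution C by fact
  interpret pair_prob_space B C ..
  note [measurable] = cdf_borel_measurable[OF A(1)]
  \<comment> \<open>The maximum of independent variables with laws \<open>B\<close> and
    \<open>C\<close> has the product of the distribution functions as its own, so the first integral
    falls under the two-variable identity.\<close>
  define D where "D = distr (B \<Otimes>\<^sub>M C) borel (\<lambda>(x, y). max x y)"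
  have D: "real_distribution D"
    unfolding D_def by (intro P.real_distribution_distr) measurable
  have "cdf D x = cdf B x * cdf C x" for x
  proof -
    have "cdf D x = measure (B \<Otimes>\<^sub>M C) ({..x} \<times> {..x})"
      unfolding D_def cdf_def
      by (subst measure_distr) (auto intro!: arg_cong[where f = "measure _"] simp: space_pair_measure)
    also have "\<dots> = cdf B x * cdf C x"
      by (simp add: cdf_def measure_def C.emeasure_pair_measure_Times enn2real_mult)
    finally show ?thesis .
  qed
  then have "(\<integral>x. cdf B x * cdf C x \<partial>A) + (\<integral>x. cdf A x \<partial>D) = 1"
    using integral_cdf_add_swap[OF D A] by simp
  moreover have "(\<integral>x. cdf A x \<partial>D) = (\<integral>(x, y). cdf A (max x y) \<partial>(B \<Otimes>\<^sub>M C))"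
    unfolding D_def by (subst integral_distr) (auto simp: case_prod_beta')
  \<comment> \<open>Split by which argument is the maximum; ties go to the first.\<close>
  moreover have "\<dots> = (\<integral>(x, y). cdf A x * of_bool (y \<le> x) \<partial>(B \<Otimes>\<^sub>M C))
      + (\<integral>(x, y). cdf A y * of_bool (x < y) \<partial>(B \<Otimes>\<^sub>M C))"
  proof -
    have int: "integrable (B \<Otimes>\<^sub>M C) (\<lambda>(x, y). cdf A x * of_bool (y \<le> x))"
      "integrable (B \<Otimes>\<^sub>M C) (\<lambda>(x, y). cdf A y * of_bool (x < y))"
      by (rule P.integrable_const_bound[where B = 1];
          auto simp: A.cdf_bounded_prob A.cdf_nonneg)+
    have "(case z of (x, y) \<Rightarrow> cdf A (max x y)) = (case z of (x, y) \<Rightarrow> cdf A x * of_bool (y \<le> x))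
        + (case z of (x, y) \<Rightarrow> cdf A y * of_bool (x < y))" for z
      by (cases z) (auto simp: max_def)
    then show ?thesis
      unfolding Bochner_Integration.integral_add[OF int, symmetric] by presburger
  qed
  moreover have "(\<integral>(x, y). cdf A x * of_bool (y \<le> x) \<partial>(B \<Otimes>\<^sub>M C)) = (\<integral>x. cdf A x * cdf C x \<partial>B)"
    by (rule integral_mult_cdf_le[OF B(1) C(1), symmetric])
       (auto simp: A.cdf_bounded_prob A.cdf_nonneg)
  moreover have "(\<integral>(x, y). cdf A y * of_bool (x < y) \<partial>(B \<Otimes>\<^sub>M C)) = (\<integral>x. cdf A x * cdf B x \<partial>C)"
    using integral_mult_cdf_less[OF C(1) B, of "cdf A"]
      integral_pair_swap[OF B(1) C(1), of "\<lambda>x y. cdf A y * of_bool (x < y)"]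
    by (auto simp: A.cdf_bounded_prob A.cdf_nonneg)
  ultimately show ?thesis by simp
qed

text \<open>For \<theta> in the unit interval this is the variance 1/12 of \<open>H(X)\<close>,
  uniform when \<open>X\<close> has distribution function \<open>H\<close>. Instead of building the
  mixture as a measure, the proof expands the square and evaluates each moment by the symmetric
  identities above.\<close>

lemma mixture_integral_square:
  assumes F: "real_distribution F" "continuous_on UNIV (cdf F)"
    and G: "real_distribution G" "continuous_on UNIV (cdf G)"
  shows "\<theta> * (\<integral>x. (mixture_cdf \<theta> F G x - 1/2)\<^sup>2 \<partial>F)
    + (1 - \<theta>) * (\<integral>x. (mixture_cdf \<theta> F G x - 1/2)\<^sup>2 \<partial>G) = 1/12"
proof -
  interpret F: real_distribution F by fact
  interpret G: real_distribution G by fact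
  note [measurable] = cdf_borel_measurable[OF F(1)] cdf_borel_measurable[OF G(1)]
  have intF: "integrable F f" if "f \<in> borel_measurable borel" "\<And>x. \<bar>f x\<bar> \<le> 1" for f :: "real \<Rightarrow> real"
    using that by (intro F.integrable_const_bound[where B = 1]) auto
  have intG: "integrable G f" if "f \<in> borel_measurable borel" "\<And>x. \<bar>f x\<bar> \<le> 1" for f :: "real \<Rightarrow> real"
    using that by (intro G.integrable_const_bound[where B = 1]) auto
  have b: "\<bar>cdf F x\<bar> \<le> 1" "\<bar>cdf G x\<bar> \<le> 1" for x
    by (simp_all add: F.cdf_bounded_prob F.cdf_nonneg G.cdf_bounded_prob G.cdf_nonneg)
  have b2: "\<bar>cdf F x * cdf F x\<bar> \<le> 1" "\<bar>cdf F x * cdf G x\<bar> \<le> 1" "\<bar>cdf G x * cdf G x\<bar> \<le> 1" for x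
    by (simp_all add: abs_mult mult_le_one[OF b(1) _ b(1)] mult_le_one[OF b(1) _ b(2)] mult_le_one[OF b(2) _ b(2)] del: abs_mult_self_eq)
  have meas: "(\<lambda>x. cdf F x * cdf F x) \<in> borel_measurable borel"
    "(\<lambda>x. cdf F x * cdf G x) \<in> borel_measurable borel"
    "(\<lambda>x. cdf G x * cdf G x) \<in> borel_measurable borel" by measurable
  note ints = intF[OF cdf_borel_measurable[OF F(1)] b(1)] intF[OF cdf_borel_measurable[OF G(1)] b(2)]
    intG[OF cdf_borel_measurable[OF F(1)] b(1)] intG[OF cdf_borel_measurable[OF G(1)] b(2)]
    intF[OF meas(1) b2(1)] intF[OF meas(2) b2(2)] intF[OF meas(3) b2(3)]
    intG[OF meas(1) b2(1)] intG[OF meas(2) b2(2)] intG[OF meas(3) b2(3)]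
  have sq: "(mixture_cdf \<theta> F G x - 1/2)\<^sup>2 = \<theta>\<^sup>2 * (cdf F x * cdf F x)
      + 2 * \<theta> * (1 - \<theta>) * (cdf F x * cdf G x) + (1 - \<theta>)\<^sup>2 * (cdf G x * cdf G x)
      - \<theta> * cdf F x - (1 - \<theta>) * cdf G x + 1/4" for x
    unfolding mixture_cdf_def by (simp add: power2_eq_square algebra_simps)
  define fff where "fff = (\<integral>x. cdf F x * cdf F x \<partial>F)"
  define fgf where "fgf = (\<integral>x. cdf F x * cdf G x \<partial>F)"
  define ggf where "ggf = (\<integral>x. cdf G x * cdf G x \<partial>F)"
  define ffg where "ffg = (\<integral>x. cdf F x * cdf F x \<partial>G)"
  define fgg where "fgg = (\<integral>x. cdf F x * cdf G x \<partial>G)"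
  define ggg where "ggg = (\<integral>x. cdf G x * cdf G x \<partial>G)"
  define ff where "ff = (\<integral>x. cdf F x \<partial>F)"
  define gf where "gf = (\<integral>x. cdf G x \<partial>F)"
  define fg where "fg = (\<integral>x. cdf F x \<partial>G)"
  define gg where "gg = (\<integral>x. cdf G x \<partial>G)"
  note defs = fff_def fgf_def ggf_def ffg_def fgg_def ggg_def ff_def gf_def fg_def gg_def
  have EF: "(\<integral>x. (mixture_cdf \<theta> F G x - 1/2)\<^sup>2 \<partial>F)
      = \<theta>\<^sup>2 * fff + 2 * \<theta> * (1 - \<theta>) * fgf + (1 - \<theta>)\<^sup>2 * ggf - \<theta> * ff - (1 - \<theta>) * gf + 1/4"
    unfolding sq defs by (simp add: ints F.prob_space[unfolded F.space_eq_univ])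
  have EG: "(\<integral>x. (mixture_cdf \<theta> F G x - 1/2)\<^sup>2 \<partial>G)
      = \<theta>\<^sup>2 * ffg + 2 * \<theta> * (1 - \<theta>) * fgg + (1 - \<theta>)\<^sup>2 * ggg - \<theta> * fg - (1 - \<theta>) * gg + 1/4"
    unfolding sq defs by (simp add: ints G.prob_space[unfolded G.space_eq_univ])
  \<comment> \<open>Equal laws give 1/2 and 1/3 by symmetry, mixed laws give linear relations. Only
    \<open>fg\<close>, \<open>fgf\<close> and \<open>fgg\<close> remain unknown, and they cancel in
    the weighted sum.\<close>
  have r: "ff = 1/2" "gg = 1/2" "gf = 1 - fg" "fff = 1/3" "ggg = 1/3" "ffg = 1 - 2 * fgf" "ggf = 1 - 2 * fgg"
    using integral_cdf_add_swap[OF F(1) F] integral_cdf_add_swap[OF G(1) G]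
      integral_cdf_add_swap[OF F(1) G] integral_cdf_mult_cyclic[OF F F F]
      integral_cdf_mult_cyclic[OF G G G] integral_cdf_mult_cyclic[OF F F G]
      integral_cdf_mult_cyclic[OF F G G]
    by (auto simp: defs mult.commute)
  show ?thesis
    unfolding EF EG r by (simp add: power2_eq_square field_simps)
qed

text \<open>The self-integrals are 1/2 and the two mixed ones add up to 1, so one unknown is left.
  The weighted mean of the two values is 1/2 and their difference is exactly
  \<open>(\<integral>x. cdf G x \<partial>F) - 1/2\<close>, the later
  \<open>\<delta>\<^sub>U\<close>.\<close>

lemma mixture_integral:
  assumes F: "real_distribution F" "continuous_on UNIV (cdf F)"
    and G: "real_distribution G" "continuous_on UNIV (cdf G)"
  shows "(\<integral>x. mixture_cdf \<theta> F G x \<partial>F) = 1/2 + (1 - \<theta>) * ((\<integral>x. cdf G x \<partial>F) - 1/2)"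
    and "(\<integral>x. mixture_cdf \<theta> F G x \<partial>G) = 1/2 - \<theta> * ((\<integral>x. cdf G x \<partial>F) - 1/2)"
proof -
  interpret F: real_distribution F by fact
  interpret G: real_distribution G by fact
  note [measurable] = cdf_borel_measurable[OF F(1)] cdf_borel_measurable[OF G(1)]
  have intF: "integrable F (cdf F)" "integrable F (cdf G)"
    by (auto intro!: F.integrable_const_bound[where B = 1]
        simp: F.cdf_bounded_prob F.cdf_nonneg G.cdf_bounded_prob G.cdf_nonneg)
  have intG: "integrable G (cdf F)" "integrable G (cdf G)"
    by (auto intro!: G.integrable_const_bound[where B = 1]
        simp: F.cdf_bounded_prob F.cdf_nonneg G.cdf_bounded_prob G.cdf_nonneg)
  have r: "(\<integral>x. cdf F x \<partial>F) = 1/2" "(\<integral>x. cdf G x \<partial>G) = 1/2"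
    "(\<integral>x. cdf F x \<partial>G) = 1 - (\<integral>x. cdf G x \<partial>F)"
    using integral_cdf_add_swap[OF F(1) F] integral_cdf_add_swap[OF G(1) G]
      integral_cdf_add_swap[OF F(1) G] by simp_all
  show "(\<integral>x. mixture_cdf \<theta> F G x \<partial>F) = 1/2 + (1 - \<theta>) * ((\<integral>x. cdf G x \<partial>F) - 1/2)"
    by (simp add: mixture_cdf_def intF r field_simps)
  show "(\<integral>x. mixture_cdf \<theta> F G x \<partial>G) = 1/2 - \<theta> * ((\<integral>x. cdf G x \<partial>F) - 1/2)"
    by (simp add: mixture_cdf_def intG r field_simps)
qed

text \<open>Independence makes the joint law a product, so the Fubini identity applies. This turns
  the probability in \<open>\<delta>\<^sub>U\<close> into an integral.\<close>

lemma (in prob_space) prob_less_eq_integral_cdf: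
  assumes indep: "indep_var borel X borel Z"
    and cont: "continuous_on UNIV (cdf (distr M borel Z))"
  shows "prob {\<omega> \<in> space M. Z \<omega> < X \<omega>} = (\<integral>x. cdf (distr M borel Z) x \<partial>distr M borel X)"
proof -
  have [measurable]: "random_variable borel X" "random_variable borel Z"
    using indep_var_rv1[OF indep] indep_var_rv2[OF indep] .
  have D: "real_distribution (distr M borel X)" "real_distribution (distr M borel Z)"
    by simp_all
  have "(\<integral>x. cdf (distr M borel Z) x \<partial>distr M borel X)
      = (\<integral>(x, y). of_bool (y < x) \<partial>(distr M borel X \<Otimes>\<^sub>M distr M borel Z))"
    using integral_mult_cdf_less[OF D cont, of "\<lambda>_. 1"] by simp
  also have "\<dots> = (\<integral>(x, y). of_bool (y < x) \<partial>distr M (borel \<Otimes>\<^sub>M borel) (\<lambda>\<omega>. (X \<omega>, Z \<omega>)))"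
    using indep_var_distribution_eq[of borel X borel Z] indep by simp
  also have "\<dots> = (\<integral>\<omega>. of_bool (Z \<omega> < X \<omega>) \<partial>M)"
    by (subst integral_distr) (auto simp: case_prod_unfold)
  also have "\<dots> = (\<integral>\<omega>. indicator {\<omega> \<in> space M. Z \<omega> < X \<omega>} \<omega> \<partial>M)"
    by (rule Bochner_Integration.integral_cong) (auto simp: indicator_def)
  also have "\<dots> = prob {\<omega> \<in> space M. Z \<omega> < X \<omega>}"
    by (simp add: Collect_conj_eq Int_commute)
  finally show ?thesis by simp
qed

section \<open>Uniform law of large numbers at a change point\<close>

text \<open>Hoeffding's inequality for each fixed \<open>k\<close>, then a union bound over the
  \<open>n\<close> values of \<open>k\<close>. The threshold \<open>n * \<kappa>\<close> is the same
  for all \<open>k\<close>.\<close>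

lemma (in prob_space) partial_sums_deviation:
  fixes Y :: "nat \<Rightarrow> 'a \<Rightarrow> real"
  assumes indep: "indep_vars (\<lambda>_. borel) Y {1..n}"
    and g [measurable]: "g \<in> borel_measurable borel" and g01: "\<And>x. 0 \<le> g x" "\<And>x. g x \<le> 1"
    and \<kappa>: "\<kappa> > 0"
  shows "prob {\<omega> \<in> space M. \<exists>k\<le>n. \<bar>(\<Sum>i = 1..k. g (Y i \<omega>)) - (\<Sum>i = 1..k. expectation (\<lambda>\<omega>. g (Y i \<omega>)))\<bar> > real n * \<kappa>}
    \<le> real n * (2 * exp (- 2 * real n * \<kappa>\<^sup>2))"
proof -
  have meas: "random_variable borel (Y i)" if "i \<in> {1..n}" for i
    using that indep by (auto simp: indep_vars_def)
  \<comment> \<open>The weak inequality matches Hoeffding's bound and covers the strict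
    event.\<close>
  define B where "B k = {\<omega> \<in> space M. \<bar>(\<Sum>i = 1..k. g (Y i \<omega>))
      - (\<Sum>i = 1..k. expectation (\<lambda>\<omega>. g (Y i \<omega>)))\<bar> \<ge> real n * \<kappa>}" for k
  have B_sets: "B k \<in> events" if "k \<in> {1..n}" for k
  proof -
    have "(\<lambda>\<omega>. \<Sum>i = 1..k. g (Y i \<omega>)) \<in> borel_measurable M"
      using that by (intro borel_measurable_sum measurable_compose[OF meas g]) auto
    then show ?thesis unfolding B_def by measurable
  qed
  have B_le: "prob (B k) \<le> 2 * exp (- 2 * real n * \<kappa>\<^sup>2)" if k: "k \<in> {1..n}" for k
  proof -
    interpret H: Hoeffding_ineq M "{1..k}" "\<lambda>i \<omega>. g (Y i \<omega>)" "\<lambda>_. 0" "\<lambda>_. 1"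
      "\<Sum>i = 1..k. expectation (\<lambda>\<omega>. g (Y i \<omega>))"
    proof unfold_locales
      show "indep_vars (\<lambda>_. borel) (\<lambda>i \<omega>. g (Y i \<omega>)) {1..k}"
        using k by (intro indep_vars_compose2[OF indep_vars_subset[OF indep]]) auto
    qed (auto simp: g01)
    have "prob (B k) \<le> 2 * exp (- 2 * (real n * \<kappa>)\<^sup>2 / (\<Sum>i = 1..k. (1 - 0)\<^sup>2))"
      unfolding B_def using k \<kappa> by (intro H.Hoeffding_ineq_abs_ge) auto
    also have "\<dots> = 2 * exp (- 2 * (real n * \<kappa>)\<^sup>2 / real k)"
      by simp
    \<comment> \<open>The bound is weakest for the longest sum, \<open>k = n\<close>.\<close>
    also have "\<dots> \<le> 2 * exp (- 2 * (real n * \<kappa>)\<^sup>2 / real n)"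
      using k by (auto intro!: divide_left_mono)
    also have "\<dots> = 2 * exp (- 2 * real n * \<kappa>\<^sup>2)"
      using k by (auto simp: power2_eq_square field_simps)
    finally show ?thesis .
  qed
  have "{\<omega> \<in> space M. \<exists>k\<le>n. \<bar>(\<Sum>i = 1..k. g (Y i \<omega>)) - (\<Sum>i = 1..k. expectation (\<lambda>\<omega>. g (Y i \<omega>)))\<bar> > real n * \<kappa>}
      \<subseteq> (\<Union>k\<in>{1..n}. B k)"
  proof safe
    fix \<omega> k assume *: "\<omega> \<in> space M" "k \<le> n"
      "\<bar>(\<Sum>i = 1..k. g (Y i \<omega>)) - (\<Sum>i = 1..k. expectation (\<lambda>\<omega>. g (Y i \<omega>)))\<bar> > real n * \<kappa>"
    \<comment> \<open>For \<open>k = 0\<close> both sums are empty, so the union may start at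
      1.\<close>
    moreover from * \<kappa> have "k \<noteq> 0"
      by (intro notI) (simp add: mult_less_0_iff)
    ultimately show "\<omega> \<in> (\<Union>k\<in>{1..n}. B k)"
      by (auto simp: B_def intro!: bexI[of _ k])
  qed
  then have "prob {\<omega> \<in> space M. \<exists>k\<le>n. \<bar>(\<Sum>i = 1..k. g (Y i \<omega>)) - (\<Sum>i = 1..k. expectation (\<lambda>\<omega>. g (Y i \<omega>)))\<bar> > real n * \<kappa>}
      \<le> prob (\<Union>k\<in>{1..n}. B k)"
    using B_sets by (intro finite_measure_mono) auto
  also have "\<dots> \<le> (\<Sum>k\<in>{1..n}. prob (B k))"
    using B_sets by (intro finite_measure_subadditive_finite) auto
  also have "\<dots> \<le> (\<Sum>k\<in>{1..n}. 2 * exp (- 2 * real n * \<kappa>\<^sup>2))"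
    by (intro sum_mono B_le)
  finally show ?thesis by simp
qed

lemma sum_if_le:
  fixes a b :: real
  shows "(\<Sum>i = 1..k. if i \<le> m then a else b) = real (min k m) * a + (real k - real (min k m)) * b"
proof (induction k)
  case (Suc k)
  then show ?case
    by (cases "Suc k \<le> m") (simp_all add: min_absorb1 min_absorb2 algebra_simps)
qed simp

text \<open>Centred partial sums up to time \<open>t\<close>, rescaled, converge to \<open>drift \<theta> t\<close> times the difference
  of the two means.\<close>

definition drift :: "real \<Rightarrow> real \<Rightarrow> real" where
  "drift \<theta> t = min t \<theta> - t * \<theta>"

text \<open>Each sample size has its own probability space. Sizes below 2 are left out because they
  admit no \<open>\<tau> n\<close> with \<open>1 \<le> \<tau> n < n\<close>.\<close>

locale change_point =
  fixes F G :: "real measure" and \<theta> :: real and \<tau> :: "nat \<Rightarrow> nat"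
    and P :: "nat \<Rightarrow> 'a measure" and Y :: "nat \<Rightarrow> nat \<Rightarrow> 'a \<Rightarrow> real"
  assumes F: "real_distribution F" "continuous_on UNIV (cdf F)"
    and G: "real_distribution G" "continuous_on UNIV (cdf G)"
    and \<theta>: "0 < \<theta>" "\<theta> < 1"
    and \<tau>: "\<And>n. n \<ge> 2 \<Longrightarrow> 1 \<le> \<tau> n \<and> \<tau> n < n" "(\<lambda>n. real (\<tau> n) / real n) \<longlonglongrightarrow> \<theta>"
    and P: "\<And>n. n \<ge> 2 \<Longrightarrow> prob_space (P n)"
    and Y_indep: "\<And>n. n \<ge> 2 \<Longrightarrow> prob_space.indep_vars (P n) (\<lambda>_. borel) (Y n) {1..n}"
    and Y_F: "\<And>n i. n \<ge> 2 \<Longrightarrow> 1 \<le> i \<Longrightarrow> i \<le> \<tau> n \<Longrightarrow> distr (P n) borel (Y n i) = F"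
    and Y_G: "\<And>n i. n \<ge> 2 \<Longrightarrow> \<tau> n < i \<Longrightarrow> i \<le> n \<Longrightarrow> distr (P n) borel (Y n i) = G"
begin

text \<open>This equals \<open>min t \<theta>\<close> times the \<open>F\<close>-mean plus
  \<open>t - min t \<theta>\<close> times the \<open>G\<close>-mean, the limit of the averaged
  partial sums. It is written as mixture mean plus drift, so that centring leaves the drift term
  alone.\<close>

definition mean_path :: "(real \<Rightarrow> real) \<Rightarrow> real \<Rightarrow> real" where
  "mean_path g t = t * (\<theta> * (\<integral>x. g x \<partial>F) + (1 - \<theta>) * (\<integral>x. g x \<partial>G))
    + drift \<theta> t * ((\<integral>x. g x \<partial>F) - (\<integral>x. g x \<partial>G))"

definition deviation_event :: "(real \<Rightarrow> real) \<Rightarrow> real \<Rightarrow> nat \<Rightarrow> 'a set" where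
  "deviation_event g \<kappa> n = {\<omega> \<in> space (P n). \<exists>k\<le>n.
    \<bar>(\<Sum>i = 1..k. g (Y n i \<omega>)) / real n - mean_path g (real k / real n)\<bar> > \<kappa>}"

lemma Y_measurable: "n \<ge> 2 \<Longrightarrow> i \<in> {1..n} \<Longrightarrow> Y n i \<in> borel_measurable (P n)"
  using Y_indep[of n] prob_space.indep_vars_def[OF P[of n], of "\<lambda>_. borel" "Y n" "{1..n}"] by auto

text \<open>Scale \<open>s\<close> and centre \<open>c\<close> are free so that both
  \<open>deviation_event\<close> and the event in the Hoeffding bound are covered.\<close>

lemma partial_sums_event_sets:
  fixes g :: "real \<Rightarrow> real"
  assumes "n \<ge> 2" "g \<in> borel_measurable borel"
  shows "{\<omega> \<in> space (P n). \<exists>k\<le>n. \<bar>(\<Sum>i = 1..k. g (Y n i \<omega>)) / s - c k\<bar> > \<kappa>} \<in> sets (P n)"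
proof -
  have "{\<omega> \<in> space (P n). \<exists>k\<le>n. \<bar>(\<Sum>i = 1..k. g (Y n i \<omega>)) / s - c k\<bar> > \<kappa>}
      = (\<Union>k\<in>{..n}. {\<omega> \<in> space (P n). \<bar>(\<Sum>i = 1..k. g (Y n i \<omega>)) / s - c k\<bar> > \<kappa>})"
    by auto
  also have "\<dots> \<in> sets (P n)"
  proof (rule sets.finite_UN)
    fix k assume "k \<in> {..n}"
    then have [measurable]: "(\<lambda>\<omega>. \<Sum>i = 1..k. g (Y n i \<omega>)) \<in> borel_measurable (P n)"
      using assms by (intro borel_measurable_sum measurable_compose[OF Y_measurable assms(2)]) auto
    show "{\<omega> \<in> space (P n). \<bar>(\<Sum>i = 1..k. g (Y n i \<omega>)) / s - c k\<bar> > \<kappa>} \<in> sets (P n)"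
      by measurable
  qed simp
  finally show ?thesis .
qed

lemma deviation_event_sets:
  assumes "n \<ge> 2" "g \<in> borel_measurable borel"
  shows "deviation_event g \<kappa> n \<in> sets (P n)"
  unfolding deviation_event_def by (rule partial_sums_event_sets[OF assms])

lemma sum_expectation:
  assumes n: "n \<ge> 2" and k: "k \<le> n" and g: "g \<in> borel_measurable borel"
  shows "(\<Sum>i = 1..k. \<integral>\<omega>. g (Y n i \<omega>) \<partial>P n)
    = real (min k (\<tau> n)) * (\<integral>x. g x \<partial>F) + (real k - real (min k (\<tau> n))) * (\<integral>x. g x \<partial>G)"
proof -
  have "(\<integral>\<omega>. g (Y n i \<omega>) \<partial>P n) = (if i \<le> \<tau> n then \<integral>x. g x \<partial>F else \<integral>x. g x \<partial>G)"
    if "i \<in> {1..k}" for i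
    using that n k integral_distr[OF Y_measurable[of n i] g] Y_F[of n i] Y_G[of n i] by auto
  then show ?thesis
    unfolding sum_if_le[symmetric] by (rule sum.cong[OF refl])
qed

text \<open>Half of \<kappa> absorbs the bias caused by \<open>\<tau> n / n\<close> differing from
  \<theta>; the other half goes to the exponential bound.\<close>

lemma deviation_event_tendsto_0:
  assumes g: "g \<in> borel_measurable borel" and g01: "\<And>x. 0 \<le> g x" "\<And>x. g x \<le> 1"
    and \<kappa>: "\<kappa> > 0"
  shows "(\<lambda>n. emeasure (P n) (deviation_event g \<kappa> n)) \<longlonglongrightarrow> 0"
proof -
  interpret F: real_distribution F by (fact F)
  interpret G: real_distribution G by (fact G)
  define d where "d = (\<integral>x. g x \<partial>F) - (\<integral>x. g x \<partial>G)"
  have "0 \<le> (\<integral>x. g x \<partial>F)" "0 \<le> (\<integral>x. g x \<partial>G)"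
    using g01 by simp_all
  moreover have "(\<integral>x. g x \<partial>F) \<le> 1" "(\<integral>x. g x \<partial>G) \<le> 1"
    using g g01 by (auto intro!: F.integral_le_const G.integral_le_const
        F.integrable_const_bound[where B = 1] G.integrable_const_bound[where B = 1])
  ultimately have d: "\<bar>d\<bar> \<le> 1" unfolding d_def by linarith
  have min_lip: "\<bar>min x a - min x b\<bar> \<le> \<bar>a - b\<bar>" for x a b :: real
    by (auto simp: min_def)
  have "\<forall>\<^sub>F n in sequentially. \<bar>real (\<tau> n) / real n - \<theta>\<bar> < \<kappa> / 2"
    using tendstoD[OF \<tau>(2), of "\<kappa> / 2"] \<kappa> by (simp add: dist_real_def)
  then have le: "\<forall>\<^sub>F n in sequentially. emeasure (P n) (deviation_event g \<kappa> n)
      \<le> ennreal (real n * (2 * exp (- 2 * real n * (\<kappa> / 2)\<^sup>2)))"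
    using eventually_ge_at_top[of 2]
  proof eventually_elim
    case (elim n)
    interpret prob_space "P n" using elim P by simp
    have "deviation_event g \<kappa> n \<subseteq> {\<omega> \<in> space (P n). \<exists>k\<le>n. \<bar>(\<Sum>i = 1..k. g (Y n i \<omega>))
        - (\<Sum>i = 1..k. expectation (\<lambda>\<omega>. g (Y n i \<omega>)))\<bar> > real n * (\<kappa> / 2)}"
    proof
      fix \<omega> assume "\<omega> \<in> deviation_event g \<kappa> n"
      then obtain k where k: "k \<le> n" and \<omega>: "\<omega> \<in> space (P n)"
        and dev: "\<bar>(\<Sum>i = 1..k. g (Y n i \<omega>)) / real n - mean_path g (real k / real n)\<bar> > \<kappa>"
        by (auto simp: deviation_event_def)
      \<comment> \<open>The bias comes from two minima only. As \<open>min\<close> is 1-Lipschitz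
        and \<open>\<bar>d\<bar> \<le> 1\<close>, it is at most the distance of
        \<open>\<tau> n / n\<close> from \<theta>, for all \<open>k\<close> at once.\<close>
      have "(\<Sum>i = 1..k. expectation (\<lambda>\<omega>. g (Y n i \<omega>))) / real n - mean_path g (real k / real n)
          = d * (min (real k / real n) (real (\<tau> n) / real n) - min (real k / real n) \<theta>)"
        unfolding sum_expectation[OF elim(2) k g] mean_path_def drift_def d_def
        using elim by (simp add: min_def field_simps)
      moreover have "\<bar>min (real k / real n) (real (\<tau> n) / real n) - min (real k / real n) \<theta>\<bar> < \<kappa> / 2"
        using elim(1) min_lip[of "real k / real n" "real (\<tau> n) / real n" \<theta>] by linarith
      ultimately have "\<bar>(\<Sum>i = 1..k. expectation (\<lambda>\<omega>. g (Y n i \<omega>))) / real n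
          - mean_path g (real k / real n)\<bar> < \<kappa> / 2"
        using mult_right_mono[OF d, of "\<bar>min (real k / real n) (real (\<tau> n) / real n) - min (real k / real n) \<theta>\<bar>"]
        by (simp add: abs_mult)
      with dev have "\<bar>((\<Sum>i = 1..k. g (Y n i \<omega>)) - (\<Sum>i = 1..k. expectation (\<lambda>\<omega>. g (Y n i \<omega>)))) / real n\<bar> > \<kappa> / 2"
        unfolding diff_divide_distrib by linarith
      then have "\<bar>(\<Sum>i = 1..k. g (Y n i \<omega>)) - (\<Sum>i = 1..k. expectation (\<lambda>\<omega>. g (Y n i \<omega>)))\<bar> > real n * (\<kappa> / 2)"
        using elim by (simp add: abs_divide field_simps)
      with k \<omega> show "\<omega> \<in> {\<omega> \<in> space (P n). \<exists>k\<le>n. \<bar>(\<Sum>i = 1..k. g (Y n i \<omega>))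
        - (\<Sum>i = 1..k. expectation (\<lambda>\<omega>. g (Y n i \<omega>)))\<bar> > real n * (\<kappa> / 2)}" by auto
    qed
    moreover have "{\<omega> \<in> space (P n). \<exists>k\<le>n. \<bar>(\<Sum>i = 1..k. g (Y n i \<omega>))
        - (\<Sum>i = 1..k. expectation (\<lambda>\<omega>. g (Y n i \<omega>)))\<bar> > real n * (\<kappa> / 2)} \<in> sets (P n)"
      using partial_sums_event_sets[OF elim(2) g, where s = 1
          and c = "\<lambda>k. \<Sum>i = 1..k. expectation (\<lambda>\<omega>. g (Y n i \<omega>))" and \<kappa> = "real n * (\<kappa> / 2)"]
      unfolding div_by_1 .
    ultimately have "prob (deviation_event g \<kappa> n) \<le> prob {\<omega> \<in> space (P n). \<exists>k\<le>n. \<bar>(\<Sum>i = 1..k. g (Y n i \<omega>))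
        - (\<Sum>i = 1..k. expectation (\<lambda>\<omega>. g (Y n i \<omega>)))\<bar> > real n * (\<kappa> / 2)}"
      by (rule finite_measure_mono)
    also have "\<dots> \<le> real n * (2 * exp (- 2 * real n * (\<kappa> / 2)\<^sup>2))"
      using partial_sums_deviation[OF Y_indep[OF elim(2)] g g01, of "\<kappa> / 2"] \<kappa> by simp
    finally show ?case
      by (simp add: emeasure_eq_measure ennreal_leI)
  qed
  have "(\<lambda>n. real n * (2 * exp (- 2 * real n * (\<kappa> / 2)\<^sup>2))) \<longlonglongrightarrow> 0"
    using \<kappa> by real_asymp
  then have "(\<lambda>n. ennreal (real n * (2 * exp (- 2 * real n * (\<kappa> / 2)\<^sup>2)))) \<longlonglongrightarrow> 0"
    using tendsto_ennrealI by fastforce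
  then show ?thesis
    by (rule tendsto_sandwich[OF always_eventually le tendsto_const, rotated]) simp
qed

end

section \<open>Deterministic approximation of the rank statistics\<close>

text \<open>The squeezing argument of Polya and Glivenko-Cantelli: monotonicity controls
  \<open>E\<close> between neighbouring quantiles of \<open>H\<close>. The grid depends on
  \<open>H\<close> and \<kappa> alone, so a random \<open>E\<close> has to be controlled at finitely
  many fixed points.\<close>

lemma monotone_approx_on_grid:
  fixes H :: "real \<Rightarrow> real"
  assumes cont: "continuous_on UNIV H"
    and bot: "(H \<longlongrightarrow> 0) at_bot" and top: "(H \<longlongrightarrow> 1) at_top" and mono: "mono H"
    and \<kappa>: "\<kappa> > 0"
  obtains X where "finite X"
    "\<And>E y. \<lbrakk>mono E; \<And>x. 0 \<le> E x; \<And>x. E x \<le> 1; \<And>x. x \<in> X \<Longrightarrow> \<bar>E x - H x\<bar> \<le> \<kappa>\<rbrakk>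
      \<Longrightarrow> \<bar>E y - H y\<bar> \<le> 2 * \<kappa>"
proof -
  obtain m :: nat where m: "inverse (real (Suc m)) < \<kappa>"
    using reals_Archimedean[OF \<kappa>] by blast
  \<comment> \<open>The mesh \<open>1 / N\<close> is below \<kappa>, so a grid error plus one mesh
    width stays within \<open>2 * \<kappa>\<close>.\<close>
  define N where "N = Suc m"
  have N: "N > 0" "1 / real N < \<kappa>" using m by (auto simp: N_def inverse_eq_divide)
  have "\<exists>x. H x = v" if v: "0 < v" "v < 1" for v
  proof -
    obtain a where a: "H a < v"
      using order_tendstoD(2)[OF bot v(1)] eventually_happens trivial_limit_at_bot_linorder by blast
    obtain b where b: "v < H b"
      using order_tendstoD(1)[OF top v(2)] eventually_happens trivial_limit_at_top_linorder by blast
    have "a \<le> b" using a b monoD[OF mono, of b a] by linarith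
    then show ?thesis
      using IVT'[of H a v b] a b continuous_on_subset[OF cont] by auto
  qed
  then have "\<exists>x. H x = real l / real N" if "l \<in> {1..<N}" for l
    using that by auto
  then obtain x where x: "\<And>l. l \<in> {1..<N} \<Longrightarrow> H (x l) = real l / real N"
    by metis
  show ?thesis
  proof (rule that)
    show "finite (x ` {1..<N})" by simp
    fix E y assume E: "mono E" "\<And>z. 0 \<le> E z" "\<And>z. E z \<le> 1"
      and approx: "\<And>z. z \<in> x ` {1..<N} \<Longrightarrow> \<bar>E z - H z\<bar> \<le> \<kappa>"
    have xE: "\<bar>E (x l) - real l / real N\<bar> \<le> \<kappa>" if "l \<in> {1..<N}" for l
      using approx[of "x l"] x[OF that] that by simp
    have "H y \<ge> 0"
      using tendsto_upperbound[OF bot, of "H y"] mono eventually_at_bot_linorder monoD by (metis trivial_limit_at_bot_linorder)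
    have "H y \<le> 1"
      using tendsto_lowerbound[OF top, of "H y"] mono eventually_at_top_linorder monoD by (metis trivial_limit_at_top_linorder)
    have "E y \<le> H y + 2 * \<kappa>"
    proof (cases "H y < 1 - 1 / real N")
      case True
      \<comment> \<open>The least integer strictly above \<open>N * H y\<close>. \<open>H\<close>
        may be flat, so strictness is what yields \<open>y \<le> x l\<close>.\<close>
      define l where "l = nat \<lfloor>real N * H y\<rfloor> + 1"
      have l: "real l = of_int \<lfloor>real N * H y\<rfloor> + 1"
        using \<open>H y \<ge> 0\<close> by (simp add: l_def)
      have "real l > real N * H y" "real l \<le> real N * H y + 1"
        unfolding l by linarith+
      moreover have "real N * H y + 1 < real N"
        using True N by (simp add: field_simps)
      ultimately have lN: "l \<in> {1..<N}" and le: "H y < real l / real N" "real l / real N \<le> H y + 1 / real N"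
        using N by (auto simp: l_def field_simps)
      have "y \<le> x l"
        using le(1) x[OF lN] monoD[OF mono, of "x l" y] by linarith
      then have "E y \<le> E (x l)" using E(1) by (auto dest: monoD)
      then show ?thesis using xE[OF lN] le(2) N(2) by linarith
    next
      \<comment> \<open>Within one mesh width of 1 there may be no grid point above, but
        \<open>E y \<le> 1\<close> suffices.\<close>
      case False
      then show ?thesis using E(3)[of y] N(2) \<kappa> by linarith
    qed
    moreover have "E y \<ge> H y - 2 * \<kappa>"
    proof (cases "H y > 1 / real N")
      case True
      \<comment> \<open>Mirror image: the greatest integer strictly below
        \<open>N * H y\<close>.\<close>
      define l where "l = nat (\<lceil>real N * H y\<rceil> - 1)"
      have "real N * H y > 1" using True N by (simp add: field_simps)
      then have l: "real l = of_int \<lceil>real N * H y\<rceil> - 1" "l \<ge> 1"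
        unfolding l_def by linarith+
      have "real l < real N * H y" "real l \<ge> real N * H y - 1"
        unfolding l by linarith+
      moreover have "real N * H y \<le> real N"
        using \<open>H y \<le> 1\<close> by (simp add: mult_left_le)
      ultimately have "real l < real N" by linarith
      moreover have "H y > real l / real N" "(real l + 1) / real N \<ge> H y"
        using N \<open>real l < real N * H y\<close> \<open>real l \<ge> real N * H y - 1\<close>
        by (simp_all add: pos_divide_less_eq pos_le_divide_eq mult.commute)
      ultimately have lN: "l \<in> {1..<N}" and le: "H y > real l / real N" "real l / real N \<ge> H y - 1 / real N"
        using l(2) by (simp_all add: add_divide_distrib)
      have "x l \<le> y"
        using le(1) x[OF lN] monoD[OF mono, of y "x l"] by linarith
      then have "E (x l) \<le> E y" using E(1) by (auto dest: monoD)
      then show ?thesis using xE[OF lN] le(2) N(2) by linarith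
    next
      case False
      then show ?thesis using E(2)[of y] N(2) \<kappa> by linarith
    qed
    ultimately show "\<bar>E y - H y\<bar> \<le> 2 * \<kappa>" by linarith
  qed
qed

section \<open>Rank sums compared with sums of limiting values\<close>

lemma abs_sum_diff_le:
  fixes f g :: "nat \<Rightarrow> real"
  assumes "k \<le> n" "0 \<le> c" "\<And>i. i \<in> {1..n} \<Longrightarrow> \<bar>f i - g i\<bar> \<le> c"
  shows "\<bar>(\<Sum>i = 1..k. f i) - (\<Sum>i = 1..k. g i)\<bar> \<le> real n * c"
proof -
  have "\<bar>(\<Sum>i = 1..k. f i) - (\<Sum>i = 1..k. g i)\<bar> \<le> (\<Sum>i = 1..k. \<bar>f i - g i\<bar>)"
    by (simp flip: sum_subtractf)
  also have "\<dots> \<le> (\<Sum>i = 1..k. c)"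
    using assms by (intro sum_mono) auto
  also have "\<dots> \<le> real n * c"
    using assms by (simp add: mult_right_mono)
  finally show ?thesis .
qed

lemma abs_square_diff_le:
  fixes x y :: real
  assumes "\<bar>x - y\<bar> \<le> c" "\<bar>x + y\<bar> \<le> 2"
  shows "\<bar>x\<^sup>2 - y\<^sup>2\<bar> \<le> 2 * c"
proof -
  have "\<bar>x\<^sup>2 - y\<^sup>2\<bar> = \<bar>x + y\<bar> * \<bar>x - y\<bar>"
    by (simp add: power2_eq_square square_diff_square_factored abs_mult)
  also have "\<dots> \<le> 2 * c"
    using assms by (intro mult_mono) auto
  finally show ?thesis .
qed

context
  fixes n :: nat and y v :: "nat \<Rightarrow> real" and \<kappa> :: real
  assumes n: "n \<ge> 1"
    and v: "\<And>i. i \<in> {1..n} \<Longrightarrow> 0 \<le> v i" "\<And>i. i \<in> {1..n} \<Longrightarrow> v i \<le> 1"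
    and rank: "\<And>i. i \<in> {1..n} \<Longrightarrow> \<bar>sample_rank n y i / real n - v i\<bar> \<le> \<kappa>"
begin

lemma rank_approx_nonneg: "0 \<le> \<kappa>"
  using rank[of 1] n by simp

text \<open>Later \<open>v i\<close> is \<open>H\<close> at the i-th observation. The centred
  statistic is exactly \<open>n\<close> times a sum of centred scaled ranks, so a termwise error
  bound carries over to the average.\<close>

lemma U_stat_approx:
  assumes k: "k \<le> n"
  shows "\<bar>(U_stat n y k - real k * (real n - real k) / 2) / (real n)\<^sup>2
    - (\<Sum>i = 1..k. v i - 1 / 2) / real n\<bar> \<le> \<kappa> + 1 / real n"
proof -
  \<comment> \<open>The centre is \<open>(n + 1) / 2\<close> divided by \<open>n\<close>; its excess
    over 1/2 is absorbed by \<open>1 / n\<close>.\<close>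
  define r where "r i = sample_rank n y i / real n - (1/2 + 1 / (2 * real n))" for i
  have "U_stat n y k - real k * (real n - real k) / 2 = real n * (\<Sum>i = 1..k. r i)"
    using n by (simp add: U_stat_def r_def sum_subtractf sum_divide_distrib[symmetric] sum_distrib_left[symmetric] field_simps)
  then have "(U_stat n y k - real k * (real n - real k) / 2) / (real n)\<^sup>2 = (\<Sum>i = 1..k. r i) / real n"
    using n by (simp add: power2_eq_square)
  moreover have "\<bar>(\<Sum>i = 1..k. r i) - (\<Sum>i = 1..k. v i - 1/2)\<bar> \<le> real n * (\<kappa> + 1 / real n)"
  proof (rule abs_sum_diff_le[OF k])
    fix i assume i: "i \<in> {1..n}"
    have "0 \<le> 1 / real n" "1 / (2 * real n) = 1 / real n / 2" by simp_all
    then show "\<bar>r i - (v i - 1/2)\<bar> \<le> \<kappa> + 1 / real n"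
      using rank[OF i] unfolding r_def abs_le_iff by linarith
  qed (use rank_approx_nonneg in simp)
  ultimately show ?thesis
    using n by (simp add: diff_divide_distrib[symmetric] abs_divide pos_divide_le_eq mult.commute)
qed

lemma M_stat_approx:
  assumes k: "k \<le> n"
  shows "\<bar>(M_stat n y k - real k * ((real n)\<^sup>2 - 1) / 12) / real n ^ 3
    - (\<Sum>i = 1..k. (v i - 1 / 2)\<^sup>2 - 1 / 12) / real n\<bar> \<le> 2 * \<kappa> + 2 / real n"
proof -
  define r where "r i = sample_rank n y i / real n - (1/2 + 1 / (2 * real n))" for i
  \<comment> \<open>Dividing \<open>((real n)\<^sup>2 - 1) / 12\<close> by
    \<open>(real n)\<^sup>2\<close> leaves 1/12 up to a term of order
    \<open>1 / (real n)\<^sup>2\<close>.\<close>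
  have "M_stat n y k - real k * ((real n)\<^sup>2 - 1) / 12
    = (real n)\<^sup>2 * (\<Sum>i = 1..k. (r i)\<^sup>2 - (1 - 1 / (real n)\<^sup>2) / 12)"
  proof -
    have "sample_rank n y i - (real n + 1) / 2 = real n * r i" for i
      using n unfolding r_def by (simp add: field_simps)
    then have "(sample_rank n y i - (real n + 1) / 2)\<^sup>2 = (real n)\<^sup>2 * (r i)\<^sup>2" for i
      by (simp add: power_mult_distrib)
    moreover have "(real n)\<^sup>2 * (real k * ((1 - 1 / (real n)\<^sup>2) / 12)) = real k * ((real n)\<^sup>2 - 1) / 12"
      using n by (simp add: field_simps)
    ultimately show ?thesis
      by (simp add: M_stat_def sum_subtractf sum_distrib_left[symmetric] right_diff_distrib
          del: times_divide_eq_right)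
  qed
  then have "(M_stat n y k - real k * ((real n)\<^sup>2 - 1) / 12) / real n ^ 3
      = (\<Sum>i = 1..k. (r i)\<^sup>2 - (1 - 1 / (real n)\<^sup>2) / 12) / real n"
    using n by (simp add: power2_eq_square power3_eq_cube)
  moreover have "\<bar>(\<Sum>i = 1..k. (r i)\<^sup>2 - (1 - 1 / (real n)\<^sup>2) / 12)
      - (\<Sum>i = 1..k. (v i - 1/2)\<^sup>2 - 1/12)\<bar> \<le> real n * (2 * \<kappa> + 2 / real n)"
  proof (rule abs_sum_diff_le[OF k])
    fix i assume i: "i \<in> {1..n}"
    define z where "z = 1 / real n"
    have z: "0 \<le> z" "z \<le> 1" "1 / (2 * real n) = z / 2" "2 / real n = 2 * z"
      using n by (auto simp: z_def)
    have n2: "0 \<le> 1 / (real n)\<^sup>2" "1 / (real n)\<^sup>2 \<le> z"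
      using n by (auto simp: z_def power2_eq_square field_simps)
    have "0 \<le> sample_rank n y i" "sample_rank n y i \<le> real n"
      unfolding sample_rank_def
      using sum_mono[of "{1..n}" "\<lambda>j. of_bool (y j \<le> y i)" "\<lambda>_. 1 :: real"]
      by (auto intro!: sum_nonneg)
    then have s: "0 \<le> sample_rank n y i / real n" "sample_rank n y i / real n \<le> 1"
      using n by (simp_all add: divide_le_eq)
    have "\<bar>(r i)\<^sup>2 - (v i - 1/2)\<^sup>2\<bar> \<le> 2 * (\<kappa> + z / 2)"
    proof (rule abs_square_diff_le)
      show "\<bar>r i - (v i - 1/2)\<bar> \<le> \<kappa> + z / 2"
        using rank[OF i] z(1) unfolding r_def z(3) abs_le_iff by linarith
      show "\<bar>r i + (v i - 1/2)\<bar> \<le> 2"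
        using s v[OF i] z(1,2) unfolding r_def z(3) abs_le_iff by linarith
    qed
    \<comment> \<open>Error budget: \<open>2 * \<kappa> + z\<close> from the squares and at most
      \<open>z / 12\<close> from the centring.\<close>
    moreover have "\<bar>(p - (1 - e) / 12) - (q - 1/12)\<bar> \<le> 2 * \<kappa> + 2 * z"
      if "\<bar>p - q\<bar> \<le> 2 * (\<kappa> + z / 2)" "0 \<le> e" "e \<le> z" for p q e
      using that unfolding abs_le_iff by (auto simp: field_simps)
    ultimately show "\<bar>((r i)\<^sup>2 - (1 - 1 / (real n)\<^sup>2) / 12) - ((v i - 1/2)\<^sup>2 - 1/12)\<bar> \<le> 2 * \<kappa> + 2 / real n"
      using n2 unfolding z(4) by blast
  qed (use rank_approx_nonneg in simp)
  ultimately show ?thesis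
    using n by (simp add: diff_divide_distrib[symmetric] abs_divide pos_divide_le_eq mult.commute)
qed

end

text \<open>The factor \<open>1 + 1 / n\<close> cancels \<open>N + 1\<close> in both denominators.
  It and the division by \<open>n\<close> do not depend on \<open>k\<close>, so the maximizers stay
  the same.\<close>

lemma lepage_scaled:
  assumes "n \<ge> 3" "0 < k" "k < n"
  defines "t \<equiv> real k / real n"
  shows "lepage n y k / real n * (1 + 1 / real n)
    = (12 * ((U_stat n y k - real k * (real n - real k) / 2) / (real n)\<^sup>2)\<^sup>2
      + 180 * (1 / (1 - 4 / (real n)\<^sup>2)) * ((M_stat n y k - real k * ((real n)\<^sup>2 - 1) / 12) / real n ^ 3)\<^sup>2)
      / (t * (1 - t))"
proof -
  define N where "N = real n"
  define K where "K = real k"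
  define a where "a = U_stat n y k - K * (N - K) / 2"
  define b where "b = M_stat n y k - K * (N\<^sup>2 - 1) / 12"
  have N: "N \<ge> 3" "0 < K" "K < N" using assms by (auto simp: N_def K_def)
  have N2: "N\<^sup>2 - 4 > 0" using N power_mono[of 3 N 2] by simp
  have w: "1 / (1 - 4 / N\<^sup>2) = N\<^sup>2 / (N\<^sup>2 - 4)"
    using N by (simp add: field_simps)
  have tt: "K / N * (1 - K / N) = K * (N - K) / N\<^sup>2"
    using N by (simp add: field_simps power2_eq_square)
  have "a\<^sup>2 / (K * (N - K) * (N + 1) / 12) / N * (1 + 1 / N) = 12 * (a / N\<^sup>2)\<^sup>2 / (K * (N - K) / N\<^sup>2)"
    using N by (simp add: divide_simps) (simp add: power2_eq_square power4_eq_xxxx algebra_simps)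
  moreover have "b\<^sup>2 / (K * (N - K) * (N + 1) * (N\<^sup>2 - 4) / 180) / N * (1 + 1 / N)
      = 180 * (N\<^sup>2 / (N\<^sup>2 - 4)) * (b / N ^ 3)\<^sup>2 / (K * (N - K) / N\<^sup>2)"
    using N N2 by (simp add: divide_simps) (simp add: eval_nat_numeral algebra_simps)
  ultimately show ?thesis
    unfolding lepage_def Let_def t_def N_def[symmetric] K_def[symmetric] a_def[symmetric] b_def[symmetric]
    unfolding w tt by (simp add: add_divide_distrib distrib_right)
qed

section \<open>The limit profile and the maximizer\<close>

text \<open>The profile peaks at \<theta> with value \<open>\<theta> * (1 - \<theta>)\<close>, and
  the gap is exactly \<open>(\<theta> - t) * ((1 - \<theta>) / (1 - t))\<close> on the left and
  \<open>(t - \<theta>) * (\<theta> / t)\<close> on the right. The lower bound separates far points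
  from the peak; the upper bound serves the true change point, which is only near \<theta>.\<close>

lemma drift_square_gap:
  assumes \<theta>: "0 < \<theta>" "\<theta> < 1" and t: "0 < t" "t < 1"
  shows "min \<theta> (1 - \<theta>) * \<bar>t - \<theta>\<bar> \<le> \<theta> * (1 - \<theta>) - (drift \<theta> t)\<^sup>2 / (t * (1 - t))"
    and "\<theta> * (1 - \<theta>) - (drift \<theta> t)\<^sup>2 / (t * (1 - t)) \<le> \<bar>t - \<theta>\<bar>"
proof -
  let ?g = "\<theta> * (1 - \<theta>) - (drift \<theta> t)\<^sup>2 / (t * (1 - t))"
  have "min \<theta> (1 - \<theta>) * \<bar>t - \<theta>\<bar> \<le> ?g \<and> ?g \<le> \<bar>t - \<theta>\<bar>"
  proof (cases "t \<le> \<theta>")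
    case True
    have "drift \<theta> t = t * (1 - \<theta>)"
      using True by (simp add: drift_def algebra_simps)
    then have g: "?g = (\<theta> - t) * ((1 - \<theta>) / (1 - t))"
      using t by (simp add: divide_simps) (simp add: power2_eq_square algebra_simps)
    have "min \<theta> (1 - \<theta>) \<le> 1 - \<theta>" "1 - \<theta> \<le> (1 - \<theta>) / (1 - t)" "(1 - \<theta>) / (1 - t) \<le> 1"
      using True \<theta> t by (auto simp: divide_simps mult_left_le)
    then show ?thesis
      using True mult_left_mono[of "min \<theta> (1 - \<theta>)" "(1 - \<theta>) / (1 - t)" "\<theta> - t"]
        mult_left_mono[of "(1 - \<theta>) / (1 - t)" 1 "\<theta> - t"]
      unfolding g by (simp add: mult.commute)
  next
    case False
    have "drift \<theta> t = \<theta> * (1 - t)"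
      using False by (simp add: drift_def algebra_simps)
    then have g: "?g = (t - \<theta>) * (\<theta> / t)"
      using t by (simp add: divide_simps) (simp add: power2_eq_square algebra_simps)
    have "min \<theta> (1 - \<theta>) \<le> \<theta>" "\<theta> \<le> \<theta> / t" "\<theta> / t \<le> 1"
      using False \<theta> t by (auto simp: divide_simps mult_left_le)
    then show ?thesis
      using False mult_left_mono[of "min \<theta> (1 - \<theta>)" "\<theta> / t" "t - \<theta>"]
        mult_left_mono[of "\<theta> / t" 1 "t - \<theta>"]
      unfolding g by (simp add: mult.commute)
  qed
  then show "min \<theta> (1 - \<theta>) * \<bar>t - \<theta>\<bar> \<le> ?g" "?g \<le> \<bar>t - \<theta>\<bar>" by auto
qed

lemma abs_drift_le:
  assumes "0 < \<theta>" "\<theta> < 1" "0 \<le> t" "t \<le> 1"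
  shows "\<bar>drift \<theta> t\<bar> \<le> 1"
proof -
  have "0 \<le> t * \<theta>" "t * \<theta> \<le> t" "t * \<theta> \<le> \<theta>"
    using assms by (simp_all add: mult_left_le mult_left_le_one_le)
  then show ?thesis
    unfolding drift_def abs_le_iff using assms by linarith
qed

text \<open>The constant is \<open>12 * 3 + 180 * 2 * 3\<close>.\<close>

lemma weighted_squares_approx:
  fixes A B a b h w \<kappa> :: real
  assumes A: "\<bar>A - h * a\<bar> \<le> \<kappa>" and B: "\<bar>B - h * b\<bar> \<le> \<kappa>" and \<kappa>: "\<kappa> \<le> 1"
    and le: "\<bar>h\<bar> \<le> 1" "\<bar>a\<bar> \<le> 1" "\<bar>b\<bar> \<le> 1" and w: "0 \<le> w" "w \<le> 2"
  shows "\<bar>(12 * A\<^sup>2 + 180 * w * B\<^sup>2) - h\<^sup>2 * (12 * a\<^sup>2 + 180 * w * b\<^sup>2)\<bar> \<le> 1116 * \<kappa>"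
proof -
  \<comment> \<open>The 3 bounds \<open>\<bar>x + h * c\<bar>\<close>, which is at most
    \<open>2 + \<kappa>\<close>.\<close>
  have sq: "\<bar>x\<^sup>2 - (h * c)\<^sup>2\<bar> \<le> 3 * \<kappa>" if "\<bar>x - h * c\<bar> \<le> \<kappa>" "\<bar>c\<bar> \<le> 1" for x c
  proof -
    have "\<bar>h * c\<bar> \<le> 1"
      using le(1) that(2) by (simp add: abs_mult mult_le_one)
    then have "\<bar>x + h * c\<bar> \<le> 3"
      using that(1) \<kappa> by linarith
    then have "\<bar>x + h * c\<bar> * \<bar>x - h * c\<bar> \<le> 3 * \<kappa>"
      using that(1) by (intro mult_mono) auto
    then show ?thesis
      by (simp add: power2_eq_square square_diff_square_factored abs_mult[symmetric])
  qed
  have "\<bar>w * (B\<^sup>2 - (h * b)\<^sup>2)\<bar> \<le> 2 * (3 * \<kappa>)"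
    using w sq[OF B le(3)] unfolding abs_mult by (intro mult_mono) auto
  moreover have "(12 * A\<^sup>2 + 180 * w * B\<^sup>2) - h\<^sup>2 * (12 * a\<^sup>2 + 180 * w * b\<^sup>2)
      = 12 * (A\<^sup>2 - (h * a)\<^sup>2) + 180 * (w * (B\<^sup>2 - (h * b)\<^sup>2))"
    by (simp add: power_mult_distrib algebra_simps)
  moreover have "\<bar>12 * p + 180 * r\<bar> \<le> 1116 * \<kappa>" if "\<bar>p\<bar> \<le> 3 * \<kappa>" "\<bar>r\<bar> \<le> 2 * (3 * \<kappa>)" for p r
    using that by linarith
  ultimately show ?thesis
    using sq[OF A le(2)] by presburger
qed

text \<open>The exact weight \<open>w = 1 / (1 - 4/n\<^sup>2)\<close> is kept instead of its limit 1: it does not depend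
  on \<open>k\<close>, so it only changes the positive factor in front of the common limit profile.\<close>

lemma lepage_argmax_near:
  fixes y :: "nat \<Rightarrow> real" and a b \<theta> \<epsilon> \<kappa> :: real
  defines "c \<equiv> 12 * a\<^sup>2 + 180 * b\<^sup>2" and "m \<equiv> min \<theta> (1 - \<theta>)"
  assumes n: "n \<ge> 3"
    and U: "\<And>k. k \<le> n \<Longrightarrow> \<bar>(U_stat n y k - real k * (real n - real k) / 2) / (real n)\<^sup>2
      - drift \<theta> (real k / real n) * a\<bar> \<le> \<kappa>"
    and M: "\<And>k. k \<le> n \<Longrightarrow> \<bar>(M_stat n y k - real k * ((real n)\<^sup>2 - 1) / 12) / real n ^ 3
      - drift \<theta> (real k / real n) * b\<bar> \<le> \<kappa>"
    and \<kappa>: "\<kappa> \<le> 1" and ab: "\<bar>a\<bar> \<le> 1" "\<bar>b\<bar> \<le> 1" "c > 0"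
    and \<theta>: "0 < \<theta>" "\<theta> < 1" and \<epsilon>: "0 < \<epsilon>" "\<epsilon> < 1"
    and k: "\<epsilon> * real n \<le> real k" "real k \<le> (1 - \<epsilon>) * real n"
    and j: "\<epsilon> * real n \<le> real j" "real j \<le> (1 - \<epsilon>) * real n"
    and le: "lepage n y j \<le> lepage n y k"
  shows "m * \<bar>real k / real n - \<theta>\<bar> \<le> \<bar>real j / real n - \<theta>\<bar> + 2232 * \<kappa> / (\<epsilon>\<^sup>2 * c)"
proof -
  define w where "w = 1 / (1 - 4 / (real n)\<^sup>2)"
  define K where "K = 12 * a\<^sup>2 + 180 * w * b\<^sup>2"
  define q where "q t = (drift \<theta> t)\<^sup>2 / (t * (1 - t))" for t
  have "(real n)\<^sup>2 \<ge> 9"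
    using power_mono[of 3 "real n" 2] n by simp
  then have "0 \<le> 4 / (real n)\<^sup>2" "4 / (real n)\<^sup>2 \<le> 1 / 2"
    by (simp_all add: divide_le_eq)
  then have w: "1 \<le> w" "w \<le> 2"
    unfolding w_def by (simp_all add: pos_le_divide_eq pos_divide_le_eq)
  \<comment> \<open>As \<open>w \<ge> 1\<close>, the factor of the profile has the lower bound
    \<open>c\<close>, free of \<open>n\<close>.\<close>
  have "c \<le> K" unfolding c_def K_def using w by (simp add: mult_right_le_one_le mult_le_cancel_right)
  then have "K > 0" using ab by simp
  define L where "L i = lepage n y i / real n * (1 + 1 / real n)" for i
  \<comment> \<open>The numerator errs by at most \<open>1116 * \<kappa>\<close>, and
    \<open>t * (1 - t)\<close> is at least \<open>\<epsilon>\<^sup>2\<close> on the search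
    range.\<close>
  define e where "e = 1116 * \<kappa> / \<epsilon>\<^sup>2"
  have approx: "\<bar>L i - K * q (real i / real n)\<bar> \<le> e"
    if i: "\<epsilon> * real n \<le> real i" "real i \<le> (1 - \<epsilon>) * real n" for i
  proof -
    define t where "t = real i / real n"
    have t: "\<epsilon> \<le> t" "t \<le> 1 - \<epsilon>"
      using i n by (simp_all add: t_def field_simps)
    then have "0 < t" "t < 1" using \<epsilon> by linarith+
    then have in_range: "0 < i" "i < n"
      using n by (auto simp: t_def zero_less_divide_iff)
    have tt: "\<epsilon>\<^sup>2 \<le> t * (1 - t)"
      unfolding power2_eq_square using t \<epsilon> by (intro mult_mono) auto
    have pos: "0 < \<epsilon>\<^sup>2" "0 < t * (1 - t)" using \<epsilon> t by auto
    define S where "S = 12 * ((U_stat n y i - real i * (real n - real i) / 2) / (real n)\<^sup>2)\<^sup>2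
      + 180 * w * ((M_stat n y i - real i * ((real n)\<^sup>2 - 1) / 12) / real n ^ 3)\<^sup>2"
    have S: "\<bar>S - (drift \<theta> t)\<^sup>2 * K\<bar> \<le> 1116 * \<kappa>"
      unfolding S_def K_def
      using in_range U[of i] M[of i] w \<theta> ab \<kappa> abs_drift_le[of \<theta> t] t \<epsilon>
      by (intro weighted_squares_approx) (auto simp: t_def)
    have "L i = S / (t * (1 - t))"
      using lepage_scaled[OF n in_range] by (simp add: L_def S_def t_def w_def)
    then have "\<bar>L i - K * q t\<bar>
        = \<bar>S - (drift \<theta> t)\<^sup>2 * K\<bar> / (t * (1 - t))"
      using pos by (simp add: q_def diff_divide_distrib[symmetric] abs_divide mult.commute)
    also have "\<dots> \<le> e"
      unfolding e_def using S tt pos by (intro frac_le) auto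
    finally show ?thesis by (simp add: t_def)
  qed
  have "L j \<le> L k"
    unfolding L_def using le by (intro mult_right_mono divide_right_mono) auto
  \<comment> \<open>The statistic at \<open>k\<close> is no smaller than at \<open>j\<close>, so
    their profiles can be out of order only by the two errors; hence the constant 2232. In the
    application \<open>j\<close> is the true change point.\<close>
  have "K * q (real j / real n) - K * q (real k / real n) \<le> 2 * e"
    using approx[OF j] approx[OF k] \<open>L j \<le> L k\<close> by linarith
  then have "q (real j / real n) - q (real k / real n) \<le> 2 * e / K"
    unfolding pos_le_divide_eq[OF \<open>K > 0\<close>] by (simp add: algebra_simps)
  also have "\<dots> \<le> 2 * e / c"
  proof -
    have "0 \<le> e" using approx[OF j] by linarith
    then show ?thesis
      using \<open>c \<le> K\<close> ab by (intro divide_left_mono mult_pos_pos) auto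
  qed
  also have "\<dots> = 2232 * \<kappa> / (\<epsilon>\<^sup>2 * c)" by (simp add: e_def)
  finally have "q (real j / real n) - q (real k / real n) \<le> 2232 * \<kappa> / (\<epsilon>\<^sup>2 * c)" .
  moreover have unit: "0 < real i / real n" "real i / real n < 1"
    if "\<epsilon> * real n \<le> real i" "real i \<le> (1 - \<epsilon>) * real n" for i
  proof -
    have "\<epsilon> \<le> real i / real n" "real i / real n \<le> 1 - \<epsilon>"
      using that n by (simp_all add: field_simps)
    then show "0 < real i / real n" "real i / real n < 1" using \<epsilon> by linarith+
  qed
  \<comment> \<open>The lower gap bound is used at \<open>k\<close>, the upper one at
    \<open>j\<close>; the peak value cancels.\<close>
  ultimately show ?thesis
    using drift_square_gap(1)[OF \<theta> unit[OF k]] drift_square_gap(2)[OF \<theta> unit[OF j]]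
    unfolding q_def m_def by linarith
qed

section \<open>Uniform limits of the rank statistics in the change-point model\<close>

lemma mixture_cdf_continuous_mono:
  assumes F: "real_distribution F" "continuous_on UNIV (cdf F)"
    and G: "real_distribution G" "continuous_on UNIV (cdf G)"
    and \<theta>: "0 < \<theta>" "\<theta> < 1"
  shows "continuous_on UNIV (mixture_cdf \<theta> F G)" "mono (mixture_cdf \<theta> F G)"
    "(mixture_cdf \<theta> F G \<longlongrightarrow> 0) at_bot" "(mixture_cdf \<theta> F G \<longlongrightarrow> 1) at_top"
    "0 \<le> mixture_cdf \<theta> F G x" "mixture_cdf \<theta> F G x \<le> 1"
proof -
  interpret F: real_distribution F by fact
  interpret G: real_distribution G by fact
  have eq: "mixture_cdf \<theta> F G = (\<lambda>x. \<theta> * cdf F x + (1 - \<theta>) * cdf G x)"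
    by (simp add: fun_eq_iff mixture_cdf_def)
  show "continuous_on UNIV (mixture_cdf \<theta> F G)"
    unfolding eq by (intro continuous_intros F(2) G(2))
  show "mono (mixture_cdf \<theta> F G)"
    unfolding eq using \<theta>
    by (intro monoI add_mono mult_left_mono F.cdf_nondecreasing G.cdf_nondecreasing) auto
  have "((\<lambda>x. \<theta> * cdf F x + (1 - \<theta>) * cdf G x) \<longlongrightarrow> \<theta> * 0 + (1 - \<theta>) * 0) at_bot"
    by (intro tendsto_intros F.cdf_lim_at_bot G.cdf_lim_at_bot)
  then show "(mixture_cdf \<theta> F G \<longlongrightarrow> 0) at_bot" unfolding eq by simp
  have "((\<lambda>x. \<theta> * cdf F x + (1 - \<theta>) * cdf G x) \<longlongrightarrow> \<theta> * 1 + (1 - \<theta>) * 1) at_top"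
    by (intro tendsto_intros F.cdf_lim_at_top_prob G.cdf_lim_at_top_prob)
  then show "(mixture_cdf \<theta> F G \<longlongrightarrow> 1) at_top" unfolding eq by simp
  show "0 \<le> mixture_cdf \<theta> F G x"
    using \<theta> by (simp add: mixture_cdf_def F.cdf_nonneg G.cdf_nonneg)
  show "mixture_cdf \<theta> F G x \<le> 1"
    using \<theta> unfolding mixture_cdf_def
    by (intro convex_bound_le F.cdf_bounded_prob G.cdf_bounded_prob) auto
qed

context change_point
begin

abbreviation "H \<equiv> mixture_cdf \<theta> F G"

abbreviation "H2 \<equiv> (\<lambda>x. (H x - 1/2)\<^sup>2)"

lemma H_measurable: "H \<in> borel_measurable borel"
  by (intro borel_measurable_continuous_onI mixture_cdf_continuous_mono[OF F G \<theta>])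

lemma H2_le_1: "H2 x \<le> 1"
  using mixture_cdf_continuous_mono(5,6)[OF F G \<theta>, of x] power_le_one[of "\<bar>H x - 1/2\<bar>" 2]
  by (auto simp: abs_le_iff)

text \<open>The drift vanishes at time 1. For this test function the full average is the empirical
  distribution function at \<open>x\<close>, so its limit is \<open>H x\<close>.\<close>

lemma mean_path_indicator: "mean_path (\<lambda>z. of_bool (z \<le> x)) 1 = H x"
proof -
  have "(\<lambda>z. of_bool (z \<le> x) :: real) = indicator {..x}"
    by (auto simp: indicator_def)
  then show ?thesis
    using \<theta> F(1) G(1)
    by (simp add: mean_path_def drift_def mixture_cdf_def cdf_def real_distribution.space_eq_univ)
qed

text \<open>The term \<open>t / 2\<close> is removed by centring at 1/2; the drift term remains. The
  next lemma does the same for the squares and 1/12.\<close>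

lemma mean_path_H:
  "mean_path H t = t / 2 + drift \<theta> t * ((\<integral>x. cdf G x \<partial>F) - 1/2)"
  unfolding mean_path_def mixture_integral[OF F G] by (simp add: field_simps)

lemma mean_path_H2:
  "mean_path H2 t = t / 12 + drift \<theta> t * ((\<integral>x. H2 x \<partial>F) - (\<integral>x. H2 x \<partial>G))"
  unfolding mean_path_def mixture_integral_square[OF F G] by simp

text \<open>The set \<open>B n\<close> collects the large deviations of finitely many test
  functions. Outside it the argument is deterministic: grid control gives the ranks, the ranks give
  both statistics.\<close>

lemma uniform_approximation:
  assumes \<kappa>: "\<kappa> > 0"
  obtains B where "\<And>n. n \<ge> 2 \<Longrightarrow> B n \<in> sets (P n)" "(\<lambda>n. emeasure (P n) (B n)) \<longlonglongrightarrow> 0"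
    "\<forall>\<^sub>F n in sequentially. \<forall>\<omega>\<in>space (P n) - B n. \<forall>k\<le>n.
      \<bar>(U_stat n (\<lambda>i. Y n i \<omega>) k - real k * (real n - real k) / 2) / (real n)\<^sup>2
        - drift \<theta> (real k / real n) * ((\<integral>x. cdf G x \<partial>F) - 1/2)\<bar> \<le> \<kappa> \<and>
      \<bar>(M_stat n (\<lambda>i. Y n i \<omega>) k - real k * ((real n)\<^sup>2 - 1) / 12) / real n ^ 3
        - drift \<theta> (real k / real n) * ((\<integral>x. H2 x \<partial>F) - (\<integral>x. H2 x \<partial>G))\<bar> \<le> \<kappa>"
proof -
  \<comment> \<open>With \<open>1 / n < \<mu>\<close> the worst error, that of \<open>M\<close>, is
    below \<open>4 * \<mu> + 2 * \<mu> + \<mu>\<close>, so an eighth of \<kappa> is enough.\<close>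
  define \<mu> where "\<mu> = \<kappa> / 8"
  have \<mu>: "\<mu> > 0" using \<kappa> by (simp add: \<mu>_def)
  note H = mixture_cdf_continuous_mono[OF F G \<theta>]
  obtain X where X: "finite X"
    "\<And>E y. \<lbrakk>mono E; \<And>x. 0 \<le> E x; \<And>x. E x \<le> 1; \<And>x. x \<in> X \<Longrightarrow> \<bar>E x - H x\<bar> \<le> \<mu>\<rbrakk>
      \<Longrightarrow> \<bar>E y - H y\<bar> \<le> 2 * \<mu>"
    using monotone_approx_on_grid[OF H(1,3,4,2) \<mu>] by blast
  \<comment> \<open>\<open>H\<close> and \<open>H2\<close> drive the sums for \<open>U\<close> and
    \<open>M\<close>; the half-line indicators at grid points control the empirical distribution
    function.\<close>
  define \<Phi> where "\<Phi> = insert H (insert H2 ((\<lambda>x z. of_bool (z \<le> x)) ` X))"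
  have \<Phi>: "finite \<Phi>" "\<And>g. g \<in> \<Phi> \<Longrightarrow> g \<in> borel_measurable borel"
    "\<And>g x. g \<in> \<Phi> \<Longrightarrow> 0 \<le> g x" "\<And>g x. g \<in> \<Phi> \<Longrightarrow> g x \<le> 1"
    using X(1) H(5,6) H_measurable H2_le_1 by (auto simp: \<Phi>_def)
  define B where "B n = (\<Union>g\<in>\<Phi>. deviation_event g \<mu> n)" for n
  show ?thesis
  proof (rule that)
    show B_sets: "B n \<in> sets (P n)" if "n \<ge> 2" for n
      unfolding B_def using \<Phi> that by (intro sets.finite_UN deviation_event_sets) auto
    have "(\<lambda>n. \<Sum>g\<in>\<Phi>. emeasure (P n) (deviation_event g \<mu> n)) \<longlonglongrightarrow> (\<Sum>g\<in>\<Phi>. 0)"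
      using \<Phi> \<mu> by (intro tendsto_sum deviation_event_tendsto_0) auto
    then have lim: "(\<lambda>n. \<Sum>g\<in>\<Phi>. emeasure (P n) (deviation_event g \<mu> n)) \<longlonglongrightarrow> 0" by simp
    have "\<forall>\<^sub>F n in sequentially. emeasure (P n) (B n) \<le> (\<Sum>g\<in>\<Phi>. emeasure (P n) (deviation_event g \<mu> n))"
      using eventually_ge_at_top[of 2]
    proof eventually_elim
      case (elim n)
      show ?case unfolding B_def
        using elim \<Phi> by (intro emeasure_subadditive_finite) (auto intro!: deviation_event_sets)
    qed
    then show "(\<lambda>n. emeasure (P n) (B n)) \<longlonglongrightarrow> 0"
      by (rule tendsto_sandwich[OF always_eventually _ tendsto_const lim, rotated]) simp
    have "\<forall>\<^sub>F n in sequentially. 1 / real n < \<mu>"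
      using \<mu> by real_asymp
    then show "\<forall>\<^sub>F n in sequentially. \<forall>\<omega>\<in>space (P n) - B n. \<forall>k\<le>n.
      \<bar>(U_stat n (\<lambda>i. Y n i \<omega>) k - real k * (real n - real k) / 2) / (real n)\<^sup>2
        - drift \<theta> (real k / real n) * ((\<integral>x. cdf G x \<partial>F) - 1/2)\<bar> \<le> \<kappa> \<and>
      \<bar>(M_stat n (\<lambda>i. Y n i \<omega>) k - real k * ((real n)\<^sup>2 - 1) / 12) / real n ^ 3
        - drift \<theta> (real k / real n) * ((\<integral>x. H2 x \<partial>F) - (\<integral>x. H2 x \<partial>G))\<bar> \<le> \<kappa>"
      using eventually_ge_at_top[of 2]
    proof eventually_elim
      case (elim n)
      show ?case
      proof (intro ballI allI impI)
        fix \<omega> k assume \<omega>: "\<omega> \<in> space (P n) - B n" and k: "k \<le> n"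
        let ?y = "\<lambda>i. Y n i \<omega>"
        have n: "n \<ge> 1" using elim by simp
        have dev: "\<bar>(\<Sum>i = 1..l. g (?y i)) / real n - mean_path g (real l / real n)\<bar> \<le> \<mu>"
          if "g \<in> \<Phi>" "l \<le> n" for g l
          using that \<omega> by (force simp: B_def deviation_event_def)
        \<comment> \<open>The empirical distribution function; at an observation it is the rank
          divided by \<open>n\<close>.\<close>
        define E where "E z = (\<Sum>j = 1..n. of_bool (?y j \<le> z)) / real n" for z
        have E_le: "(\<Sum>j = 1..n. of_bool (?y j \<le> z)) \<le> real n" for z
          using sum_mono[of "{1..n}" "\<lambda>j. of_bool (?y j \<le> z)" "\<lambda>_. 1 :: real"] by simp
        have "\<bar>E z - H z\<bar> \<le> 2 * \<mu>" for z
        proof (rule X(2))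
          show "mono E"
            unfolding E_def by (intro monoI divide_right_mono sum_mono) auto
          show "0 \<le> E x" "E x \<le> 1" for x
            using n E_le[of x] by (auto simp: E_def divide_le_eq intro!: sum_nonneg divide_nonneg_nonneg)
          show "\<bar>E x - H x\<bar> \<le> \<mu>" if "x \<in> X" for x
            using dev[of "\<lambda>z. of_bool (z \<le> x)" n] that n mean_path_indicator[of x]
            by (simp add: E_def \<Phi>_def)
        qed
        then have rank: "\<bar>sample_rank n ?y i / real n - H (?y i)\<bar> \<le> 2 * \<mu>" for i
          by (simp add: E_def sample_rank_def)
        have triangle: "\<bar>u - s\<bar> \<le> \<kappa>" if "\<bar>u - v\<bar> \<le> c" "\<bar>v - s\<bar> \<le> \<mu>" "c + \<mu> \<le> \<kappa>" for u v s c :: real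
          using that by linarith
        have "\<bar>(\<Sum>i = 1..k. H (?y i) - 1 / 2) / real n
            - drift \<theta> (real k / real n) * ((\<integral>x. cdf G x \<partial>F) - 1/2)\<bar> \<le> \<mu>"
          using dev[of H k] k n
          by (simp add: \<Phi>_def mean_path_H sum_subtractf diff_divide_distrib algebra_simps)
        moreover have "\<bar>(\<Sum>i = 1..k. H2 (?y i) - 1 / 12) / real n
            - drift \<theta> (real k / real n) * ((\<integral>x. H2 x \<partial>F) - (\<integral>x. H2 x \<partial>G))\<bar> \<le> \<mu>"
          using dev[of H2 k] k n
          by (simp add: \<Phi>_def mean_path_H2 sum_subtractf diff_divide_distrib algebra_simps)
        moreover note U_stat_approx[of n "\<lambda>i. H (?y i)" ?y "2 * \<mu>" k, OF n H(5,6) rank k]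
          M_stat_approx[of n "\<lambda>i. H (?y i)" ?y "2 * \<mu>" k, OF n H(5,6) rank k]
        moreover have "2 * \<mu> + 1 / real n + \<mu> \<le> \<kappa>" "2 * (2 * \<mu>) + 2 / real n + \<mu> \<le> \<kappa>"
          using elim(1) \<mu> unfolding \<mu>_def by (auto simp: field_simps)
        ultimately show "\<bar>(U_stat n ?y k - real k * (real n - real k) / 2) / (real n)\<^sup>2
            - drift \<theta> (real k / real n) * ((\<integral>x. cdf G x \<partial>F) - 1/2)\<bar> \<le> \<kappa> \<and>
          \<bar>(M_stat n ?y k - real k * ((real n)\<^sup>2 - 1) / 12) / real n ^ 3
            - drift \<theta> (real k / real n) * ((\<integral>x. H2 x \<partial>F) - (\<integral>x. H2 x \<partial>G))\<bar> \<le> \<kappa>"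
          by (blast intro: triangle)
      qed
    qed
  qed
qed

end

section \<open>Consistency of the maximizer\<close>

theorem proposition2:
  fixes F G :: "real measure"
    and \<theta> \<epsilon> :: real
    and \<tau> :: "nat \<Rightarrow> nat"
    and P :: "nat \<Rightarrow> 'a measure"
    and Y :: "nat \<Rightarrow> nat \<Rightarrow> 'a \<Rightarrow> real"
    and Q :: "'b measure"
    and X\<^sub>F X\<^sub>G :: "'b \<Rightarrow> real"
    and \<delta>\<^sub>U \<delta>\<^sub>M :: real
    and \<tau>hat :: "nat \<Rightarrow> 'a \<Rightarrow> nat"
  assumes F: "real_distribution F" "continuous_on UNIV (cdf F)"
    and G: "real_distribution G" "continuous_on UNIV (cdf G)"
    and \<theta>: "0 < \<theta>" "\<theta> < 1"
    and \<tau>: "\<And>n. n \<ge> 2 \<Longrightarrow> 1 \<le> \<tau> n \<and> \<tau> n < n" "(\<lambda>n. real (\<tau> n) / real n) \<longlonglongrightarrow> \<theta>"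
    and P: "\<And>n. n \<ge> 2 \<Longrightarrow> prob_space (P n)"
    and Y_indep: "\<And>n. n \<ge> 2 \<Longrightarrow> prob_space.indep_vars (P n) (\<lambda>_. borel) (Y n) {1..n}"
    and Y_F: "\<And>n i. n \<ge> 2 \<Longrightarrow> 1 \<le> i \<Longrightarrow> i \<le> \<tau> n \<Longrightarrow> distr (P n) borel (Y n i) = F"
    and Y_G: "\<And>n i. n \<ge> 2 \<Longrightarrow> \<tau> n < i \<Longrightarrow> i \<le> n \<Longrightarrow> distr (P n) borel (Y n i) = G"
    and Q: "prob_space Q" "prob_space.indep_var Q borel X\<^sub>F borel X\<^sub>G"
      "distr Q borel X\<^sub>F = F" "distr Q borel X\<^sub>G = G"
    and \<delta>\<^sub>U: "\<delta>\<^sub>U = measure Q {\<omega> \<in> space Q. X\<^sub>F \<omega> > X\<^sub>G \<omega>} - 1 / 2"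
    and \<delta>\<^sub>M: "\<delta>\<^sub>M = (\<integral>\<omega>. (mixture_cdf \<theta> F G (X\<^sub>F \<omega>) - 1 / 2)\<^sup>2 \<partial>Q)
      - (\<integral>\<omega>. (mixture_cdf \<theta> F G (X\<^sub>G \<omega>) - 1 / 2)\<^sup>2 \<partial>Q)"
    and \<epsilon>: "0 < \<epsilon>" "\<epsilon> < \<theta>" "\<theta> < 1 - \<epsilon>"
    and \<tau>hat: "\<forall>\<^sub>F n in sequentially. \<forall>\<omega>\<in>space (P n).
      is_arg_max (\<lambda>k. lepage n (\<lambda>i. Y n i \<omega>) k)
        (\<lambda>k. \<epsilon> * real n \<le> real k \<and> real k \<le> (1 - \<epsilon>) * real n) (\<tau>hat n \<omega>)"
    and \<delta>: "\<delta>\<^sub>U\<^sup>2 + \<delta>\<^sub>M\<^sup>2 > 0"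
  shows "converges_in_prob P (\<lambda>n \<omega>. real (\<tau>hat n \<omega>) / real n) \<theta>"
proof -
  interpret change_point F G \<theta> \<tau> P Y
    by (rule change_point.intro) fact+
  interpret Q: prob_space Q by fact
  have X_measurable: "X\<^sub>F \<in> borel_measurable Q" "X\<^sub>G \<in> borel_measurable Q"
    using Q.indep_var_rv1[OF Q(2)] Q.indep_var_rv2[OF Q(2)] .
  have \<delta>\<^sub>U_eq: "\<delta>\<^sub>U = (\<integral>x. cdf G x \<partial>F) - 1/2"
    using Q.prob_less_eq_integral_cdf[OF Q(2)] G(2) unfolding Q(3,4) \<delta>\<^sub>U by simp
  have H2_measurable: "H2 \<in> borel_measurable borel"
    using H_measurable by measurable
  have \<delta>\<^sub>M_eq: "\<delta>\<^sub>M = (\<integral>x. H2 x \<partial>F) - (\<integral>x. H2 x \<partial>G)"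
    unfolding \<delta>\<^sub>M using integral_distr[OF X_measurable(1) H2_measurable]
      integral_distr[OF X_measurable(2) H2_measurable] by (simp add: Q(3,4))
  have H2_integral: "0 \<le> (\<integral>\<omega>. H2 (X \<omega>) \<partial>Q)" "(\<integral>\<omega>. H2 (X \<omega>) \<partial>Q) \<le> 1"
    if "X \<in> borel_measurable Q" for X
  proof -
    show "0 \<le> (\<integral>\<omega>. H2 (X \<omega>) \<partial>Q)" by simp
    have "integrable Q (\<lambda>\<omega>. H2 (X \<omega>))"
      using measurable_compose[OF that H2_measurable] H2_le_1
      by (intro Q.integrable_const_bound[where B = 1]) auto
    then show "(\<integral>\<omega>. H2 (X \<omega>) \<partial>Q) \<le> 1"
      using H2_le_1 by (intro Q.integral_le_const) auto
  qed
  have le_1: "\<bar>\<delta>\<^sub>U\<bar> \<le> 1" "\<bar>\<delta>\<^sub>M\<bar> \<le> 1"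
  proof -
    show "\<bar>\<delta>\<^sub>U\<bar> \<le> 1"
      unfolding \<delta>\<^sub>U abs_le_iff using Q.prob_le_1[of "{\<omega> \<in> space Q. X\<^sub>F \<omega> > X\<^sub>G \<omega>}"]
        measure_nonneg[of Q "{\<omega> \<in> space Q. X\<^sub>F \<omega> > X\<^sub>G \<omega>}"] by linarith
    show "\<bar>\<delta>\<^sub>M\<bar> \<le> 1"
      unfolding \<delta>\<^sub>M using H2_integral[OF X_measurable(1)] H2_integral[OF X_measurable(2)] by linarith
  qed
  define c where "c = 12 * \<delta>\<^sub>U\<^sup>2 + 180 * \<delta>\<^sub>M\<^sup>2"
  have c: "c > 0"
    unfolding c_def using \<delta> zero_le_power2[of \<delta>\<^sub>U] zero_le_power2[of \<delta>\<^sub>M] by linarith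
  define m where "m = min \<theta> (1 - \<theta>)"
  have m: "m > 0" using \<theta> by (simp add: m_def)
  have \<epsilon>1: "\<epsilon> < 1" using \<epsilon> \<theta> by simp
  show ?thesis
    unfolding converges_in_prob_def
  proof (intro allI impI)
    fix \<eta> :: real assume \<eta>: "\<eta> > 0"
    \<comment> \<open>Chosen so that the error term of \<open>lepage_argmax_near\<close> takes at
      most half of \<open>m * \<eta>\<close>; the cap 1 meets the requirement
      \<open>\<kappa> \<le> 1\<close> there.\<close>
    define \<kappa> where "\<kappa> = min 1 (m * \<eta> / 2 * (\<epsilon>\<^sup>2 * c) / 2232)"
    have \<kappa>: "0 < \<kappa>" "\<kappa> \<le> 1"
      using m \<eta> \<epsilon> c by (simp_all add: \<kappa>_def)
    have \<kappa>_bound: "2232 * \<kappa> / (\<epsilon>\<^sup>2 * c) \<le> m * \<eta> / 2"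
    proof -
      have "\<kappa> \<le> m * \<eta> / 2 * (\<epsilon>\<^sup>2 * c) / 2232" by (simp add: \<kappa>_def)
      then have "2232 * \<kappa> \<le> m * \<eta> / 2 * (\<epsilon>\<^sup>2 * c)" by simp
      moreover have "0 < \<epsilon>\<^sup>2 * c" using \<epsilon> c by simp
      ultimately show ?thesis by (simp only: pos_divide_le_eq)
    qed
    obtain B where B: "\<And>n. n \<ge> 2 \<Longrightarrow> B n \<in> sets (P n)" "(\<lambda>n. emeasure (P n) (B n)) \<longlonglongrightarrow> 0"
      and approx: "\<forall>\<^sub>F n in sequentially. \<forall>\<omega>\<in>space (P n) - B n. \<forall>k\<le>n.
        \<bar>(U_stat n (\<lambda>i. Y n i \<omega>) k - real k * (real n - real k) / 2) / (real n)\<^sup>2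
          - drift \<theta> (real k / real n) * \<delta>\<^sub>U\<bar> \<le> \<kappa> \<and>
        \<bar>(M_stat n (\<lambda>i. Y n i \<omega>) k - real k * ((real n)\<^sup>2 - 1) / 12) / real n ^ 3
          - drift \<theta> (real k / real n) * \<delta>\<^sub>M\<bar> \<le> \<kappa>"
      by (rule uniform_approximation[OF \<kappa>(1), folded \<delta>\<^sub>U_eq \<delta>\<^sub>M_eq]) blast
    \<comment> \<open>Eventually \<open>\<tau> n\<close> lies in the search range and is a
      competitor for the maximum.\<close>
    have "\<forall>\<^sub>F n in sequentially. \<epsilon> < real (\<tau> n) / real n"
      "\<forall>\<^sub>F n in sequentially. real (\<tau> n) / real n < 1 - \<epsilon>"
      using order_tendstoD[OF \<tau>(2)] \<epsilon> by auto
    moreover have "\<forall>\<^sub>F n in sequentially. \<bar>real (\<tau> n) / real n - \<theta>\<bar> < m * \<eta> / 2"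
      using tendstoD[OF \<tau>(2), of "m * \<eta> / 2"] m \<eta> by (simp add: dist_real_def)
    ultimately have le: "\<forall>\<^sub>F n in sequentially.
      outer_measure_of (P n) {\<omega> \<in> space (P n). \<bar>real (\<tau>hat n \<omega>) / real n - \<theta>\<bar> > \<eta>} \<le> emeasure (P n) (B n)"
      using approx \<tau>hat eventually_ge_at_top[of 3]
    proof eventually_elim
      case (elim n)
      have n: "n \<ge> 3" by fact
      have \<tau>_range: "\<epsilon> * real n \<le> real (\<tau> n)" "real (\<tau> n) \<le> (1 - \<epsilon>) * real n"
        using elim(1,2) n by (simp_all add: pos_less_divide_eq pos_divide_less_eq)
      \<comment> \<open>The left-hand set may fail to be measurable, but \<open>B n\<close> is
        measurable and outer measure is monotone.\<close>
      have "{\<omega> \<in> space (P n). \<bar>real (\<tau>hat n \<omega>) / real n - \<theta>\<bar> > \<eta>} \<subseteq> B n"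
      proof (rule subsetI, rule ccontr)
        fix \<omega> assume \<omega>: "\<omega> \<in> {\<omega> \<in> space (P n). \<bar>real (\<tau>hat n \<omega>) / real n - \<theta>\<bar> > \<eta>}" "\<omega> \<notin> B n"
        then have arg_max: "is_arg_max (lepage n (\<lambda>i. Y n i \<omega>))
          (\<lambda>k. \<epsilon> * real n \<le> real k \<and> real k \<le> (1 - \<epsilon>) * real n) (\<tau>hat n \<omega>)"
          using elim(5) by simp
        have "m * \<bar>real (\<tau>hat n \<omega>) / real n - \<theta>\<bar>
            \<le> \<bar>real (\<tau> n) / real n - \<theta>\<bar> + 2232 * \<kappa> / (\<epsilon>\<^sup>2 * c)"
          unfolding m_def c_def
        proof (rule lepage_argmax_near[OF n _ _ \<kappa>(2) le_1 _ \<theta> \<epsilon>(1) \<epsilon>1 _ _ \<tau>_range])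
          show "12 * \<delta>\<^sub>U\<^sup>2 + 180 * \<delta>\<^sub>M\<^sup>2 > 0" using c by (simp add: c_def)
          show "lepage n (\<lambda>i. Y n i \<omega>) (\<tau> n) \<le> lepage n (\<lambda>i. Y n i \<omega>) (\<tau>hat n \<omega>)"
            using arg_max \<tau>_range by (auto simp: is_arg_max_def not_less)
        qed (use arg_max elim(4) \<omega> in \<open>auto simp: is_arg_max_def\<close>)
        \<comment> \<open>Each summand takes half of \<open>m * \<eta>\<close>, the distance of
          \<open>\<tau> n / n\<close> from \<theta> strictly less.\<close>
        also have "\<dots> < m * \<eta>"
          using elim(3) \<kappa>_bound by linarith
        finally show False
          using m \<omega>(1) by simp
      qed
      then have "outer_measure_of (P n) {\<omega> \<in> space (P n). \<bar>real (\<tau>hat n \<omega>) / real n - \<theta>\<bar> > \<eta>}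
          \<le> outer_measure_of (P n) (B n)"
        by (rule outer_measure_of_mono)
      then show ?case
        using B(1) n by simp
    qed
    show "(\<lambda>n. outer_measure_of (P n) {\<omega> \<in> space (P n). \<bar>real (\<tau>hat n \<omega>) / real n - \<theta>\<bar> > \<eta>}) \<longlonglongrightarrow> 0"
      by (rule tendsto_sandwich[OF always_eventually le tendsto_const B(2)]) simp
  qed
qed

end
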